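(* Let $\alpha>3/4$, $R>0$ and $\lambda\in\mathbb R$. Then the quantity $$E_\alpha\Big[\mathbf 1_{\{\|\Pi_Nu\|_{L^2}\le R\}}\,e^{\lambda\|\Pi_Nu\|_{L^4}^4}\Big]$$ is bounded uniformly in $N\in\mathbb N$.
   Context: $\mathbb T=\mathbb R/(2\pi\mathbb Z)$. $E_\alpha$ is the expectation with respect to $\gamma_\alpha$, the law on $L^2(\mathbb T)$ of the random Fourier series $u=\sum_{n\in\mathbb Z}\frac{g_n}{(1+|n|^{2\alpha})^{1/2}}e^{inx}$, where $(g_n)_{n\in\mathbb Z}$ are i.i.d. standard (circular) complex centred Gaussian random variables with $E|g_n|^2=1$. $\Pi_N$ is the projection onto the Fourier modes $|n|\le N$. *)

theory Defs
  imports "HOL-Probability.Probability"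
begin

text \<open>
  Functions on the torus \<open>\<real>/(2\<pi>\<int>)\<close> are \<open>2\<pi>\<close>-periodic functions on \<open>\<real>\<close>, integrated against
  (unnormalised) Lebesgue measure over one period.
\<close>

definition torus_Lp_norm :: "real \<Rightarrow> (real \<Rightarrow> complex) \<Rightarrow> real" where
  "torus_Lp_norm p f = (LINT x:{0..2*pi}|lborel. cmod (f x) powr p) powr (1 / p)"

text \<open>
  The elements of \<open>torus_L2\<close> are representatives, not classes modulo equality almost everywhere,
  so \<open>torus_Lp_norm 2\<close> is only a seminorm on it.
\<close>

definition torus_L2 :: "(real \<Rightarrow> complex) set" where
  "torus_L2 = {f \<in> borel_measurable borel.
     (\<forall>x. f (x + 2*pi) = f x) \<and> set_integrable lborel {0..2*pi} (\<lambda>x. (cmod (f x))\<^sup>2)}"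

definition torus_L2_open :: "(real \<Rightarrow> complex) set \<Rightarrow> bool" where
  "torus_L2_open U \<longleftrightarrow> U \<subseteq> torus_L2 \<and>
     (\<forall>f\<in>U. \<exists>e>0. \<forall>h\<in>torus_L2. torus_Lp_norm 2 (\<lambda>x. h x - f x) < e \<longrightarrow> h \<in> U)"

text \<open>
  Sets that are open for the seminorm are closed under equality almost everywhere, so this
  \<open>\<sigma>\<close>-algebra is the pull-back of the Borel \<open>\<sigma>\<close>-algebra of the quotient space \<open>L\<^sup>2\<close>. The measure
  carried by \<open>sigma\<close> is irrelevant: only the measurable structure is used.
\<close>

definition torus_L2_borel :: "(real \<Rightarrow> complex) measure" where
  "torus_L2_borel = sigma torus_L2 {U. torus_L2_open U}"

definition torus_fourier_coeff :: "(real \<Rightarrow> complex) \<Rightarrow> int \<Rightarrow> complex" where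
  "torus_fourier_coeff f n =
     (LINT x:{0..2*pi}|lborel. f x * exp (- (\<i> * of_int n * of_real x))) / (2 * of_real pi)"

definition fourier_proj :: "nat \<Rightarrow> (real \<Rightarrow> complex) \<Rightarrow> real \<Rightarrow> complex" where
  "fourier_proj N f = (\<lambda>x. \<Sum>n\<in>{- int N..int N}.
     torus_fourier_coeff f n * exp (\<i> * of_int n * of_real x))"

text \<open>
  A standard circular complex Gaussian, normalised by \<open>E|g|\<^sup>2 = 1\<close>, has independent real and
  imaginary parts that are centred real Gaussians of variance \<open>1/2\<close> each
  (\<open>normal_density\<close> takes the standard deviation).
\<close>

definition std_complex_gaussian :: "'a measure \<Rightarrow> ('a \<Rightarrow> complex) \<Rightarrow> bool" where
  "std_complex_gaussian M X \<longleftrightarrow>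
     distributed M lborel (\<lambda>\<omega>. Re (X \<omega>)) (normal_density 0 (1 / sqrt 2)) \<and>
     distributed M lborel (\<lambda>\<omega>. Im (X \<omega>)) (normal_density 0 (1 / sqrt 2)) \<and>
     prob_space.indep_var M borel (\<lambda>\<omega>. Re (X \<omega>)) borel (\<lambda>\<omega>. Im (X \<omega>))"

definition iid_std_complex_gaussian :: "'a measure \<Rightarrow> (int \<Rightarrow> 'a \<Rightarrow> complex) \<Rightarrow> bool" where
  "iid_std_complex_gaussian M g \<longleftrightarrow>
     prob_space.indep_vars M (\<lambda>_. borel) g UNIV \<and> (\<forall>n. std_complex_gaussian M (g n))"

definition random_fourier_partial_sum ::
    "real \<Rightarrow> (int \<Rightarrow> 'a \<Rightarrow> complex) \<Rightarrow> nat \<Rightarrow> 'a \<Rightarrow> real \<Rightarrow> complex" where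
  "random_fourier_partial_sum \<alpha> g K \<omega> = (\<lambda>x. \<Sum>n\<in>{- int K..int K}.
     g n \<omega> / of_real (sqrt (1 + \<bar>real_of_int n\<bar> powr (2 * \<alpha>))) * exp (\<i> * of_int n * of_real x))"

definition is_random_fourier_sum ::
    "real \<Rightarrow> (int \<Rightarrow> 'a \<Rightarrow> complex) \<Rightarrow> 'a \<Rightarrow> (real \<Rightarrow> complex) \<Rightarrow> bool" where
  "is_random_fourier_sum \<alpha> g \<omega> f \<longleftrightarrow> f \<in> torus_L2 \<and>
     (\<lambda>K. torus_Lp_norm 2 (\<lambda>x. random_fourier_partial_sum \<alpha> g K \<omega> x - f x)) \<longlonglongrightarrow> 0"

text \<open>
  The sum of the series in \<open>L\<^sup>2\<close>, unique up to equality almost everywhere. For \<open>\<alpha> > 1/2\<close> and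
  i.i.d. standard Gaussian \<open>g n\<close> it exists for almost every \<open>\<omega>\<close>; the value \<open>0\<close> on the
  exceptional null set is a convention without influence on the law.
\<close>

definition random_fourier_series ::
    "real \<Rightarrow> (int \<Rightarrow> 'a \<Rightarrow> complex) \<Rightarrow> 'a \<Rightarrow> real \<Rightarrow> complex" where
  "random_fourier_series \<alpha> g \<omega> =
     (if \<exists>f. is_random_fourier_sum \<alpha> g \<omega> f then SOME f. is_random_fourier_sum \<alpha> g \<omega> f
      else (\<lambda>_. 0))"

definition gaussian_law ::
    "'a measure \<Rightarrow> (int \<Rightarrow> 'a \<Rightarrow> complex) \<Rightarrow> real \<Rightarrow> (real \<Rightarrow> complex) measure" where
  "gaussian_law M g \<alpha> = distr M torus_L2_borel (random_fourier_series \<alpha> g)"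

text \<open>The quantity under the expectation, as a function of \<open>v\<close> in \<open>torus_L2\<close>.\<close>

definition truncated_weight ::
    "real \<Rightarrow> real \<Rightarrow> nat \<Rightarrow> (real \<Rightarrow> complex) \<Rightarrow> real" where
  "truncated_weight R lam N v =
     indicator {w. torus_Lp_norm 2 (fourier_proj N w) \<le> R} v *
       exp (lam * torus_Lp_norm 4 (fourier_proj N v) ^ 4)"

end

theory Submission
  imports Defs "HOL-Library.Discrete_Functions"
begin

text \<open>
  Split \<open>\<Pi>\<^sub>N u\<close> into dyadic Fourier blocks \<open>h\<^sub>j\<close> with \<open>|n| ~ 2\<^sup>j\<close>. On \<open>\<parallel>\<Pi>\<^sub>N u\<parallel>\<^sub>2 \<le> R\<close>,
  Cauchy-Schwarz on the Fourier side gives \<open>\<parallel>h\<^sub>j\<parallel>\<^sub>4\<^sup>4 \<le> C 2\<^sup>j R\<^sup>4\<close>, so the quartic exponent is at most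
  \<open>C 2\<^bsup>j/2\<^esup> R\<^sup>2 \<parallel>h\<^sub>j\<parallel>\<^sub>4\<^sup>2\<close>. By Jensen, the exponential of this quadratic quantity is dominated by the average
  over \<open>x\<close> of \<open>exp (C 2\<^bsup>j/2\<^esup> R\<^sup>2 |h\<^sub>j(x)|\<^sup>2)\<close>, and \<open>h\<^sub>j(x)\<close> is a Gaussian of variance of order
  \<open>2\<^bsup>(1 - 2\<alpha>)j\<^esup>\<close>. Since \<open>2\<^bsup>j/2\<^esup> 2\<^bsup>(1 - 2\<alpha>)j\<^esup> \<rightarrow> 0\<close> exactly when \<open>\<alpha> > 3/4\<close>, all but finitely many blocks have a
  uniformly bounded exponential moment, with room for geometric weights \<open>p\<^sub>j\<close> that
  recombine the blocks by convexity; the remaining blocks are bounded deterministically.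
\<close>

section \<open>Trigonometric polynomials on the torus\<close>

text \<open>One period as a finite measure space, so that Fubini, Jensen and Fatou apply directly to
  the torus variable.\<close>

definition torus :: "real measure" where
  "torus = restrict_space lborel {0..2*pi}"

text \<open>Arbitrary frequency sets cover Fourier projections, dyadic blocks and differences of
  partial sums at once.\<close>

definition trig :: "int set \<Rightarrow> (int \<Rightarrow> complex) \<Rightarrow> real \<Rightarrow> complex" where
  "trig A c x = (\<Sum>n\<in>A. c n * exp (\<i> * of_int n * of_real x))"

lemma set_integral_torus:
  fixes f :: "real \<Rightarrow> 'b :: {banach, second_countable_topology}"
  shows "(LINT x:{0..2*pi}|lborel. f x) = (LINT x|torus. f x)"
  unfolding torus_def set_lebesgue_integral_def by (subst integral_restrict_space) auto

lemma set_integrable_torus: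
  fixes f :: "real \<Rightarrow> 'b :: {banach, second_countable_topology}"
  shows "set_integrable lborel {0..2*pi} f \<longleftrightarrow> integrable torus f"
  unfolding torus_def set_integrable_def by (subst integrable_restrict_space) auto

lemma emeasure_torus: "emeasure torus (space torus) = ennreal (2*pi)"
  unfolding torus_def by (simp add: emeasure_restrict_space)

lemma finite_measure_torus: "finite_measure torus"
  by (rule finite_measureI) (simp add: emeasure_torus)

interpretation torus: finite_measure torus
  by (rule finite_measure_torus)

lemma measure_torus [simp]: "measure torus (space torus) = 2*pi"
  using emeasure_torus by (simp add: measure_def)

lemma measurable_torus [measurable (raw)]:
  "f \<in> measurable borel N \<Longrightarrow> f \<in> measurable torus N"
  unfolding torus_def by (intro measurable_restrict_space1) simp

lemma measurable_fst_torus [measurable]: "fst \<in> measurable (torus \<Otimes>\<^sub>M M) borel"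
  by (rule measurable_compose[OF measurable_fst]) (rule measurable_torus, simp)

lemma measurable_snd_torus [measurable]: "snd \<in> measurable (M \<Otimes>\<^sub>M torus) borel"
  by (rule measurable_compose[OF measurable_snd]) (rule measurable_torus, simp)

lemma integrable_torus_continuous:
  fixes f :: "real \<Rightarrow> 'b :: {banach, second_countable_topology}"
  assumes "continuous_on UNIV f"
  shows "integrable torus f"
  unfolding set_integrable_torus[symmetric] set_integrable_def
  by (rule borel_integrable_compact) (auto intro: continuous_on_subset[OF assms])

lemma torus_L2_iff:
  "f \<in> torus_L2 \<longleftrightarrow> f \<in> borel_measurable borel \<and> (\<forall>x. f (x + 2*pi) = f x) \<and>
     integrable torus (\<lambda>x. (cmod (f x))\<^sup>2)"
  by (simp add: torus_L2_def set_integrable_torus)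

lemma torus_Lp_norm_2: "torus_Lp_norm 2 f = sqrt (LINT x|torus. (cmod (f x))\<^sup>2)"
  by (simp add: torus_Lp_norm_def set_integral_torus powr_numeral powr_half_sqrt)

lemma torus_Lp_norm_4_power: "torus_Lp_norm 4 f ^ 4 = (LINT x|torus. cmod (f x) ^ 4)"
proof -
  define I where "I = (LINT x|torus. cmod (f x) ^ 4)"
  have "0 \<le> I"
    unfolding I_def by (intro integral_nonneg_AE) auto
  then have "(I powr (1 / 4)) ^ 4 = I"
    using powr_numeral[of "I powr (1 / 4)" "num.Bit0 (num.Bit0 num.One)"] by (simp add: powr_powr)
  then show ?thesis
    by (simp add: torus_Lp_norm_def set_integral_torus I_def)
qed

lemma torus_fourier_coeff_eq:
  "torus_fourier_coeff f n =
     (LINT x|torus. f x * exp (- (\<i> * of_int n * of_real x))) / (2 * of_real pi)"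
  by (simp add: torus_fourier_coeff_def set_integral_torus)

lemma fourier_proj_eq_trig: "fourier_proj N f = trig {- int N..int N} (torus_fourier_coeff f)"
  by (simp add: fourier_proj_def trig_def fun_eq_iff)

lemma continuous_on_trig [continuous_intros]: "continuous_on S (trig A c)"
  unfolding trig_def by (intro continuous_intros)

lemma measurable_trig [measurable]: "trig A c \<in> borel_measurable borel"
  by (intro borel_measurable_continuous_onI continuous_on_trig)

section \<open>Orthogonality of the exponentials and Parseval's identity\<close>

lemma exp_int_2pi: "exp (\<i> * of_int n * of_real (2 * pi)) = 1"
  unfolding exp_eq_1 by (auto intro!: exI[of _ n])

lemma trig_periodic: "trig A c (x + 2*pi) = trig A c x"
proof -
  have "exp (\<i> * of_int n * of_real (x + 2*pi)) = exp (\<i> * of_int n * of_real x)" for n :: int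
    using exp_int_2pi[of n] by (simp add: distrib_left exp_add)
  then show ?thesis
    by (simp only: trig_def)
qed

lemma trig_diff: "trig A c x - trig A d x = trig A (\<lambda>n. c n - d n) x"
  by (simp add: trig_def sum_subtractf left_diff_distrib)

lemma trig_diff_subset:
  "finite B \<Longrightarrow> A \<subseteq> B \<Longrightarrow> trig B c x - trig A c x = trig (B - A) c x"
  by (simp add: trig_def sum_diff)

lemma trig_L2: "trig A c \<in> torus_L2"
  unfolding torus_L2_iff
  by (auto intro!: integrable_torus_continuous continuous_intros simp: trig_periodic)

text \<open>For nonzero \<open>n\<close> the integrand has a periodic primitive.\<close>

lemma integral_torus_exp:
  "(LINT x|torus. exp (\<i> * of_int n * of_real x)) = (if n = 0 then 2 * of_real pi else 0)"
proof (cases "n = 0")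
  case True
  then show ?thesis by (simp add: scaleR_conv_of_real)
next
  case False
  let ?F = "\<lambda>x. exp (\<i> * of_int n * of_real x) / (\<i> * of_int n)"
  have "(?F has_vector_derivative exp (\<i> * of_int n * of_real x)) (at x within {0..2*pi})" for x :: real
    by (rule has_vector_derivative_real_field) (use False in \<open>auto intro!: derivative_eq_intros\<close>)
  then have "(LINT x|lborel. indicator {0..2*pi} x *\<^sub>R exp (\<i> * of_int n * of_real x)) = ?F (2*pi) - ?F 0"
    by (intro integral_FTC_Icc) (auto intro!: continuous_intros)
  also have "\<dots> = 0"
    using exp_int_2pi[of n] by simp
  finally show ?thesis
    using False by (simp add: set_lebesgue_integral_def flip: set_integral_torus)
qed

text \<open>Multiplying by the conjugate exponential shifts every frequency by \<open>n\<close>, and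
  only frequency zero has a nonzero integral.\<close>

lemma torus_fourier_coeff_trig:
  assumes "finite A"
  shows "torus_fourier_coeff (trig A c) n = (if n \<in> A then c n else 0)"
proof -
  have "(LINT x|torus. trig A c x * exp (- (\<i> * of_int n * of_real x))) =
      (LINT x|torus. (\<Sum>m\<in>A. c m * exp (\<i> * of_int (m - n) * of_real x)))"
    unfolding trig_def sum_distrib_right
    by (intro Bochner_Integration.integral_cong refl sum.cong)
      (simp add: algebra_simps flip: exp_add)
  also have "\<dots> = (\<Sum>m\<in>A. c m * (LINT x|torus. exp (\<i> * of_int (m - n) * of_real x)))"
    by (subst Bochner_Integration.integral_sum)
      (auto intro!: integrable_torus_continuous continuous_intros sum.cong)
  also have "\<dots> = (\<Sum>m\<in>A. if m = n then c m * (2 * of_real pi) else 0)"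
    by (intro sum.cong refl) (simp only: integral_torus_exp, auto)
  also have "\<dots> = (if n \<in> A then c n * (2 * of_real pi) else 0)"
    using assms by (simp add: sum.delta)
  finally show ?thesis
    by (simp add: torus_fourier_coeff_eq)
qed

text \<open>Expanding only the conjugated factor leaves a combination of Fourier coefficients of
  \<open>trig A c\<close> itself, which orthogonality has already computed.\<close>

lemma parseval_trig:
  assumes "finite A"
  shows "(LINT x|torus. (cmod (trig A c x))\<^sup>2) = 2 * pi * (\<Sum>n\<in>A. (cmod (c n))\<^sup>2)"
proof -
  have "of_real (LINT x|torus. (cmod (trig A c x))\<^sup>2) = (LINT x|torus. trig A c x * cnj (trig A c x))"
    unfolding integral_complex_of_real[symmetric] complex_norm_square ..
  also have "\<dots> = (LINT x|torus. (\<Sum>n\<in>A. cnj (c n) * (trig A c x * exp (- (\<i> * of_int n * of_real x)))))"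
    by (simp add: trig_def[of A c] sum_distrib_left exp_cnj ac_simps)
  also have "\<dots> = (\<Sum>n\<in>A. cnj (c n) * (LINT x|torus. trig A c x * exp (- (\<i> * of_int n * of_real x))))"
    by (subst Bochner_Integration.integral_sum)
      (auto intro!: integrable_torus_continuous continuous_intros)
  also have "\<dots> = (\<Sum>n\<in>A. cnj (c n) * (2 * of_real pi * torus_fourier_coeff (trig A c) n))"
    by (simp add: torus_fourier_coeff_eq)
  also have "\<dots> = (\<Sum>n\<in>A. of_real (2 * pi * (cmod (c n))\<^sup>2))"
    using assms by (intro sum.cong) (auto simp: torus_fourier_coeff_trig ac_simps simp flip: complex_norm_square)
  also have "\<dots> = of_real (2 * pi * (\<Sum>n\<in>A. (cmod (c n))\<^sup>2))"
    by (simp add: sum_distrib_left)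
  finally show ?thesis
    using of_real_eq_iff by blast
qed

text \<open>Triangle inequality, then Cauchy-Schwarz. This Bernstein-type bound converts mean-square
  control into sup control at the price of the number of frequencies.\<close>

lemma norm_trig_square_le:
  assumes "finite A"
  shows "(cmod (trig A c x))\<^sup>2 \<le> real (card A) * (\<Sum>n\<in>A. (cmod (c n))\<^sup>2)"
proof -
  have "cmod (trig A c x) \<le> (\<Sum>n\<in>A. cmod (c n))"
    unfolding trig_def by (rule sum_norm_le) (simp add: norm_mult)
  then have "(cmod (trig A c x))\<^sup>2 \<le> (\<Sum>n\<in>A. cmod (c n))\<^sup>2"
    by (intro power_mono) auto
  also have "\<dots> \<le> real (card A) * (\<Sum>n\<in>A. (cmod (c n))\<^sup>2)"
    using sum_squared_le_sum_of_squares[of "\<lambda>n. cmod (c n)" A] by (simp add: mult.commute)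
  finally show ?thesis .
qed

section \<open>Exponential moments of Gaussian sums\<close>

text \<open>Completing the square: the exponential tilt moves the mean to
  \<open>t * \<sigma>^2\<close> and leaves the variance alone.\<close>

lemma nn_integral_normal_density_exp:
  assumes "0 < \<sigma>"
  shows "(\<integral>\<^sup>+x. ennreal (normal_density 0 \<sigma> x) * ennreal (exp (t * x)) \<partial>lborel) =
    ennreal (exp (t\<^sup>2 * \<sigma>\<^sup>2 / 2))"
proof -
  have "- x\<^sup>2 / (2 * \<sigma>\<^sup>2) + t * x = t\<^sup>2 * \<sigma>\<^sup>2 / 2 + - (x - t * \<sigma>\<^sup>2)\<^sup>2 / (2 * \<sigma>\<^sup>2)" for x
    using assms
    by (simp add: power2_diff add_divide_distrib diff_divide_distrib)
      (simp add: field_simps power2_eq_square)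
  then have "exp (- x\<^sup>2 / (2 * \<sigma>\<^sup>2)) * exp (t * x) =
      exp (t\<^sup>2 * \<sigma>\<^sup>2 / 2) * exp (- (x - t * \<sigma>\<^sup>2)\<^sup>2 / (2 * \<sigma>\<^sup>2))" for x
    by (simp only: mult_exp_exp)
  then have "normal_density 0 \<sigma> x * exp (t * x) = exp (t\<^sup>2 * \<sigma>\<^sup>2 / 2) * normal_density (t * \<sigma>\<^sup>2) \<sigma> x" for x
    by (simp add: normal_density_def)
  then have "(\<integral>\<^sup>+x. ennreal (normal_density 0 \<sigma> x) * ennreal (exp (t * x)) \<partial>lborel) =
      (\<integral>\<^sup>+x. ennreal (exp (t\<^sup>2 * \<sigma>\<^sup>2 / 2)) * ennreal (normal_density (t * \<sigma>\<^sup>2) \<sigma> x) \<partial>lborel)"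
    by (simp flip: ennreal_mult')
  also have "\<dots> = ennreal (exp (t\<^sup>2 * \<sigma>\<^sup>2 / 2))"
    using assms by (simp add: nn_integral_cmult nn_integral_eq_integral)
  finally show ?thesis .
qed

text \<open>The tilt doubles the variance; \<open>sqrt 2\<close> is the ratio of the two normalising
  constants.\<close>

lemma nn_integral_std_normal_density_exp_square:
  "(\<integral>\<^sup>+x. ennreal (normal_density 0 1 x) * ennreal (exp (x\<^sup>2 / 4)) \<partial>lborel) = ennreal (sqrt 2)"
proof -
  have "normal_density 0 1 x * exp (x\<^sup>2 / 4) = sqrt 2 * normal_density 0 (sqrt 2) x" for x :: real
    by (simp add: normal_density_def real_sqrt_mult field_simps flip: exp_add)
  then have "(\<integral>\<^sup>+x. ennreal (normal_density 0 1 x) * ennreal (exp (x\<^sup>2 / 4)) \<partial>lborel) =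
      (\<integral>\<^sup>+x. ennreal (sqrt 2) * ennreal (normal_density 0 (sqrt 2) x) \<partial>lborel)"
    by (simp flip: ennreal_mult')
  also have "\<dots> = ennreal (sqrt 2)"
    by (simp add: nn_integral_cmult nn_integral_eq_integral)
  finally show ?thesis .
qed

context prob_space
begin

section \<open>Sums of independent complex Gaussians\<close>

lemma nn_integral_exp_distributed_normal:
  assumes "distributed M lborel X (normal_density 0 \<sigma>)" "0 < \<sigma>"
  shows "(\<integral>\<^sup>+\<omega>. ennreal (exp (t * X \<omega>)) \<partial>M) = ennreal (exp (t\<^sup>2 * \<sigma>\<^sup>2 / 2))"
  using distributed_nn_integral[OF assms(1), of "\<lambda>x. ennreal (exp (t * x))"]
  by (simp add: nn_integral_normal_density_exp assms(2))

text \<open>The pair is treated as a family indexed by \<open>bool\<close>, which reduces the claim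
  to the product formula for independent families.\<close>

lemma indep_var_nn_integral_mult:
  fixes X Y :: "'a \<Rightarrow> real"
  assumes ind: "indep_var borel X borel Y"
    and [measurable]: "f \<in> borel_measurable borel" "h \<in> borel_measurable borel"
  shows "(\<integral>\<^sup>+\<omega>. f (X \<omega>) * h (Y \<omega>) \<partial>M) = (\<integral>\<^sup>+\<omega>. f (X \<omega>) \<partial>M) * (\<integral>\<^sup>+\<omega>. h (Y \<omega>) \<partial>M)"
proof -
  note [measurable] = indep_var_rv1[OF ind] indep_var_rv2[OF ind]
  have "indep_var borel (f \<circ> X) borel (h \<circ> Y)"
    by (rule indep_var_compose[OF ind]) auto
  then have "indep_vars (\<lambda>_. borel) (case_bool (f \<circ> X) (h \<circ> Y)) UNIV"
    unfolding indep_var_def by (rule indep_vars_cong[THEN iffD1, rotated -1]) (auto split: bool.split)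
  then have "(\<integral>\<^sup>+\<omega>. (\<Prod>b\<in>UNIV. case_bool (f \<circ> X) (h \<circ> Y) b \<omega>) \<partial>M) =
      (\<Prod>b\<in>UNIV. \<integral>\<^sup>+\<omega>. case_bool (f \<circ> X) (h \<circ> Y) b \<omega> \<partial>M)"
    by (intro indep_vars_nn_integral) auto
  then show ?thesis
    by (simp add: UNIV_bool mult.commute comp_def)
qed

text \<open>\<open>Re (a * X)\<close> combines two independent real Gaussians of variance 1/2, so it
  has variance \<open>|a|^2 / 2\<close>; half of this is the exponent.\<close>

lemma std_complex_gaussian_exp:
  assumes "std_complex_gaussian M X"
  shows "(\<integral>\<^sup>+\<omega>. ennreal (exp (Re (a * X \<omega>))) \<partial>M) = ennreal (exp ((cmod a)\<^sup>2 / 4))"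
proof -
  from assms have X: "distributed M lborel (\<lambda>\<omega>. Re (X \<omega>)) (normal_density 0 (1 / sqrt 2))"
      "distributed M lborel (\<lambda>\<omega>. Im (X \<omega>)) (normal_density 0 (1 / sqrt 2))"
      "indep_var borel (\<lambda>\<omega>. Re (X \<omega>)) borel (\<lambda>\<omega>. Im (X \<omega>))"
    by (auto simp: std_complex_gaussian_def)
  have "(\<integral>\<^sup>+\<omega>. ennreal (exp (Re (a * X \<omega>))) \<partial>M) =
      (\<integral>\<^sup>+\<omega>. ennreal (exp (Re a * Re (X \<omega>))) * ennreal (exp (- Im a * Im (X \<omega>))) \<partial>M)"
    by (simp add: flip: ennreal_mult' exp_add)
  also have "\<dots> = (\<integral>\<^sup>+\<omega>. ennreal (exp (Re a * Re (X \<omega>))) \<partial>M) *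
      (\<integral>\<^sup>+\<omega>. ennreal (exp (- Im a * Im (X \<omega>))) \<partial>M)"
    by (rule indep_var_nn_integral_mult[OF X(3)]) auto
  also have "\<dots> = ennreal (exp ((cmod a)\<^sup>2 / 4))"
    by (subst X(1)[THEN nn_integral_exp_distributed_normal] X(2)[THEN nn_integral_exp_distributed_normal], simp)+
      (simp add: cmod_power2 power_divide add_divide_distrib flip: ennreal_mult' exp_add)
  finally show ?thesis .
qed

lemma iid_std_complex_gaussian_exp_sum:
  assumes g: "iid_std_complex_gaussian M g" and A: "finite A"
  shows "(\<integral>\<^sup>+\<omega>. ennreal (exp (Re (\<Sum>n\<in>A. a n * g n \<omega>))) \<partial>M) = ennreal (exp ((\<Sum>n\<in>A. (cmod (a n))\<^sup>2) / 4))"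
proof -
  from g have ind: "indep_vars (\<lambda>_. borel) g UNIV"
    by (simp add: iid_std_complex_gaussian_def)
  have "indep_vars (\<lambda>_. borel) (\<lambda>n \<omega>. ennreal (exp (Re (a n * g n \<omega>)))) A"
    by (rule indep_vars_compose2[OF indep_vars_subset[OF ind]]) auto
  then have "(\<integral>\<^sup>+\<omega>. (\<Prod>n\<in>A. ennreal (exp (Re (a n * g n \<omega>)))) \<partial>M) =
      (\<Prod>n\<in>A. \<integral>\<^sup>+\<omega>. ennreal (exp (Re (a n * g n \<omega>))) \<partial>M)"
    by (intro indep_vars_nn_integral A) auto
  also have "\<dots> = (\<Prod>n\<in>A. ennreal (exp ((cmod (a n))\<^sup>2 / 4)))"
    using g by (intro prod.cong refl std_complex_gaussian_exp) (simp add: iid_std_complex_gaussian_def)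
  also have "\<dots> = ennreal (exp ((\<Sum>n\<in>A. (cmod (a n))\<^sup>2) / 4))"
    by (simp add: prod_ennreal exp_sum[OF A] sum_divide_distrib)
  finally show ?thesis
    by (simp only: Re_sum exp_sum[OF A] prod_ennreal exp_ge_zero)
qed

lemma iid_std_complex_gaussian_measurable:
  "iid_std_complex_gaussian M g \<Longrightarrow> g n \<in> borel_measurable M"
  unfolding iid_std_complex_gaussian_def indep_vars_def by auto

text \<open>
  The square in the exponent is linearised by
  \<open>exp (t x\<^sup>2) = E exp (sqrt (2 t) x s)\<close> with \<open>s\<close> a standard real Gaussian.
\<close>

lemma iid_std_complex_gaussian_exp_Re_square:
  assumes g: "iid_std_complex_gaussian M g" and A: "finite A"
    and t: "0 \<le> t" "t * (\<Sum>n\<in>A. (cmod (a n))\<^sup>2) \<le> 1 / 2"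
  shows "(\<integral>\<^sup>+\<omega>. ennreal (exp (t * (Re (\<Sum>n\<in>A. a n * g n \<omega>))\<^sup>2)) \<partial>M) \<le> ennreal (sqrt 2)"
proof -
  note [measurable] = iid_std_complex_gaussian_measurable[OF g]
  define X where "X \<omega> = Re (\<Sum>n\<in>A. a n * g n \<omega>)" for \<omega>
  have [measurable]: "X \<in> borel_measurable M"
    unfolding X_def by measurable
  have "(\<integral>\<^sup>+\<omega>. ennreal (exp (t * (X \<omega>)\<^sup>2)) \<partial>M) =
      (\<integral>\<^sup>+\<omega>. (\<integral>\<^sup>+s. ennreal (normal_density 0 1 s) * ennreal (exp (sqrt (2 * t) * X \<omega> * s)) \<partial>lborel) \<partial>M)"
    using t by (simp add: nn_integral_normal_density_exp power_mult_distrib)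
  also have "\<dots> = (\<integral>\<^sup>+s. (\<integral>\<^sup>+\<omega>. ennreal (normal_density 0 1 s) * ennreal (exp (sqrt (2 * t) * X \<omega> * s)) \<partial>M) \<partial>lborel)"
  proof -
    interpret P: pair_sigma_finite lborel M
      by unfold_locales
    show ?thesis
      by (rule P.Fubini') measurable
  qed
  also have "\<dots> \<le> (\<integral>\<^sup>+s. ennreal (normal_density 0 1 s) * ennreal (exp (s\<^sup>2 / 4)) \<partial>lborel)"
  proof (rule nn_integral_mono)
    fix s :: real
    have "(\<integral>\<^sup>+\<omega>. ennreal (exp (sqrt (2 * t) * X \<omega> * s)) \<partial>M) =
        (\<integral>\<^sup>+\<omega>. ennreal (exp (Re (\<Sum>n\<in>A. (of_real (sqrt (2 * t) * s) * a n) * g n \<omega>))) \<partial>M)"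
    proof (intro nn_integral_cong)
      fix \<omega>
      have "Re (\<Sum>n\<in>A. (of_real (sqrt (2 * t) * s) * a n) * g n \<omega>) =
          Re (of_real (sqrt (2 * t) * s) * (\<Sum>n\<in>A. a n * g n \<omega>))"
        by (simp only: sum_distrib_left mult.assoc)
      also have "\<dots> = sqrt (2 * t) * X \<omega> * s"
        by (simp only: Re_complex_of_real Im_complex_of_real times_complex.sel X_def) simp
      finally show "ennreal (exp (sqrt (2 * t) * X \<omega> * s)) =
        ennreal (exp (Re (\<Sum>n\<in>A. (of_real (sqrt (2 * t) * s) * a n) * g n \<omega>)))"
        by simp
    qed
    also have "\<dots> = ennreal (exp ((\<Sum>n\<in>A. (cmod (of_real (sqrt (2 * t) * s) * a n))\<^sup>2) / 4))"
      by (rule iid_std_complex_gaussian_exp_sum[OF g A])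
    also have "(\<Sum>n\<in>A. (cmod (of_real (sqrt (2 * t) * s) * a n))\<^sup>2) = 2 * s\<^sup>2 * (t * (\<Sum>n\<in>A. (cmod (a n))\<^sup>2))"
      using t by (simp add: norm_mult power_mult_distrib sum_distrib_left ac_simps)
    \<comment> \<open>The bound 1/2 on \<open>t\<close> times the sum is what brings the exponent
      down to \<open>s^2 / 4\<close>, which the Gaussian density in \<open>s\<close> can
      absorb.\<close>
    also have "ennreal (exp (2 * s\<^sup>2 * (t * (\<Sum>n\<in>A. (cmod (a n))\<^sup>2)) / 4)) \<le> ennreal (exp (s\<^sup>2 / 4))"
      using mult_left_mono[OF t(2), of "s\<^sup>2"] by (intro ennreal_leI) (simp add: ac_simps)
    finally show "(\<integral>\<^sup>+\<omega>. ennreal (normal_density 0 1 s) * ennreal (exp (sqrt (2 * t) * X \<omega> * s)) \<partial>M)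
        \<le> ennreal (normal_density 0 1 s) * ennreal (exp (s\<^sup>2 / 4))"
      by (simp add: nn_integral_cmult mult_left_mono)
  qed
  also have "\<dots> = ennreal (sqrt 2)"
    by (rule nn_integral_std_normal_density_exp_square)
  finally show ?thesis
    by (simp add: X_def)
qed

text \<open>By convexity of \<open>exp\<close>, the squares of the real and imaginary parts are
  separated into an average of two exponentials with doubled parameter \<open>2 * t\<close>. The
  doubling is why 1/2 becomes 1/4 in the hypothesis.\<close>

lemma iid_std_complex_gaussian_exp_norm_square:
  assumes g: "iid_std_complex_gaussian M g" and A: "finite A"
    and t: "0 \<le> t" "t * (\<Sum>n\<in>A. (cmod (a n))\<^sup>2) \<le> 1 / 4"
  shows "(\<integral>\<^sup>+\<omega>. ennreal (exp (t * (cmod (\<Sum>n\<in>A. a n * g n \<omega>))\<^sup>2)) \<partial>M) \<le> ennreal (sqrt 2)"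
proof -
  note [measurable] = iid_std_complex_gaussian_measurable[OF g]
  define X where "X \<omega> = (\<Sum>n\<in>A. a n * g n \<omega>)" for \<omega>
  have [measurable]: "X \<in> borel_measurable M"
    unfolding X_def by measurable
  have "exp (t * (cmod (X \<omega>))\<^sup>2) \<le> exp (2 * t * (Re (X \<omega>))\<^sup>2) / 2 + exp (2 * t * (Im (X \<omega>))\<^sup>2) / 2" for \<omega>
    using convex_onD[OF exp_convex, of "1/2" "2 * t * (Re (X \<omega>))\<^sup>2" "2 * t * (Im (X \<omega>))\<^sup>2"]
    by (simp add: cmod_power2 distrib_left)
  moreover have half: "ennreal (u / 2 + v / 2) = ennreal (1/2) * ennreal u + ennreal (1/2) * ennreal v"
    if "0 \<le> u" "0 \<le> v" for u v :: real
    using that ennreal_mult'[of "1/2" u] ennreal_mult'[of "1/2" v] by (simp add: ennreal_plus)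
  ultimately have "(\<integral>\<^sup>+\<omega>. ennreal (exp (t * (cmod (X \<omega>))\<^sup>2)) \<partial>M) \<le>
      (\<integral>\<^sup>+\<omega>. ennreal (1/2) * ennreal (exp (2 * t * (Re (X \<omega>))\<^sup>2)) +
         ennreal (1/2) * ennreal (exp (2 * t * (Im (X \<omega>))\<^sup>2)) \<partial>M)"
    by (intro nn_integral_mono) (simp only: half[symmetric] exp_ge_zero ennreal_leI)
  also have "\<dots> = ennreal (1/2) * (\<integral>\<^sup>+\<omega>. ennreal (exp (2 * t * (Re (X \<omega>))\<^sup>2)) \<partial>M) +
      ennreal (1/2) * (\<integral>\<^sup>+\<omega>. ennreal (exp (2 * t * (Im (X \<omega>))\<^sup>2)) \<partial>M)"
    by (simp add: nn_integral_add nn_integral_cmult)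
  also have "\<dots> \<le> ennreal (1/2) * ennreal (sqrt 2) + ennreal (1/2) * ennreal (sqrt 2)"
  proof (intro add_mono mult_left_mono)
    show "(\<integral>\<^sup>+\<omega>. ennreal (exp (2 * t * (Re (X \<omega>))\<^sup>2)) \<partial>M) \<le> ennreal (sqrt 2)"
      unfolding X_def using t by (intro iid_std_complex_gaussian_exp_Re_square[OF g A]) auto
    \<comment> \<open>Rotating all coefficients by \<open>- \<i>\<close> preserves their moduli and
      turns the imaginary part into a real part.\<close>
    have "Im (X \<omega>) = Re (\<Sum>n\<in>A. (- \<i> * a n) * g n \<omega>)" for \<omega>
      by (simp add: X_def)
    then show "(\<integral>\<^sup>+\<omega>. ennreal (exp (2 * t * (Im (X \<omega>))\<^sup>2)) \<partial>M) \<le> ennreal (sqrt 2)"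
      using t iid_std_complex_gaussian_exp_Re_square[OF g A, of "2 * t" "\<lambda>n. - \<i> * a n"]
      by (simp add: norm_mult)
  qed auto
  also have "\<dots> = ennreal (sqrt 2)"
    using half[of "sqrt 2" "sqrt 2"] by simp
  finally show ?thesis
    by (simp add: X_def)
qed

end

section \<open>From the quartic to a quadratic exponent\<close>

text \<open>Jensen for the fourth power, applied to the mean of \<open>z j / p j\<close> with
  weights \<open>p j\<close>; of the resulting power \<open>p j ^ 4\<close>, one factor cancels
  against the weight.\<close>

lemma cmod_power4_sum_le:
  fixes z :: "'i \<Rightarrow> complex"
  assumes J: "finite J" "J \<noteq> {}" and p: "\<And>j. j \<in> J \<Longrightarrow> 0 < p j" "(\<Sum>j\<in>J. p j) = 1"
  shows "cmod (\<Sum>j\<in>J. z j) ^ 4 \<le> (\<Sum>j\<in>J. cmod (z j) ^ 4 / p j ^ 3)"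
proof -
  have "cmod (\<Sum>j\<in>J. z j) \<le> (\<Sum>j\<in>J. p j * (cmod (z j) / p j))"
    using p(1) by (intro sum_norm_le) (simp add: less_imp_neq[THEN not_sym])
  then have "cmod (\<Sum>j\<in>J. z j) ^ 4 \<le> (\<Sum>j\<in>J. p j *\<^sub>R (cmod (z j) / p j)) ^ 4"
    by (intro power_mono) auto
  also have "\<dots> \<le> (\<Sum>j\<in>J. p j * (cmod (z j) / p j) ^ 4)"
    by (rule convex_on_sum[OF J convex_power_even p(2)]) (use p(1) in \<open>auto intro: less_imp_le\<close>)
  also have "\<dots> = (\<Sum>j\<in>J. cmod (z j) ^ 4 / p j ^ 3)"
    using p(1) by (intro sum.cong refl) (simp add: field_simps power_divide eval_nat_numeral less_imp_neq[THEN not_sym])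
  finally show ?thesis .
qed

lemma exp_sum_le:
  fixes b :: "'i \<Rightarrow> real"
  assumes J: "finite J" "J \<noteq> {}" and p: "\<And>j. j \<in> J \<Longrightarrow> 0 < p j" "(\<Sum>j\<in>J. p j) = 1"
  shows "exp (\<Sum>j\<in>J. p j * b j) \<le> (\<Sum>j\<in>J. p j * exp (b j))"
  using convex_on_sum[OF J exp_convex p(2), of b] p(1) by (auto intro: less_imp_le)

text \<open>The second derivative has the sign of \<open>sqrt x - 1\<close>.\<close>

lemma convex_exp_sqrt: "convex_on {1<..} (\<lambda>t::real. exp (sqrt t))"
proof (rule f''_ge0_imp_convex)
  fix x :: real assume "x \<in> {1<..}"
  then have x: "1 < x" by simp
  then have s: "1 < sqrt x" "sqrt x * sqrt x = x" by auto
  show "((\<lambda>t. exp (sqrt t)) has_real_derivative exp (sqrt x) / (2 * sqrt x)) (at x)"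
    using x by (auto intro!: derivative_eq_intros simp: field_simps)
  show "((\<lambda>t. exp (sqrt t) / (2 * sqrt t)) has_real_derivative
      exp (sqrt x) * (sqrt x - 1) / (4 * (x * sqrt x))) (at x)"
    using x s by (auto intro!: derivative_eq_intros simp: divide_simps) (auto simp: algebra_simps)
  show "0 \<le> exp (sqrt x) * (sqrt x - 1) / (4 * (x * sqrt x))"
    using x s by auto
qed simp

text \<open>
  The function \<open>exp (sqrt t)\<close> is only convex for \<open>t \<ge> 1\<close>, hence the shift by \<open>2\<close> and
  the factor \<open>exp 2\<close>.
\<close>

lemma exp_sqrt_integral_le:
  assumes f: "continuous_on UNIV f" "\<And>x. 0 \<le> f x" and m: "0 \<le> m"
  shows "exp (m * sqrt ((LINT x|torus. (f x)\<^sup>2) / (2 * pi))) \<le>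
    exp 2 / (2 * pi) * (LINT x|torus. exp (m * f x))"
proof -
  \<comment> \<open>Normalised Lebesgue measure on one period, the probability measure for Jensen's
    inequality.\<close>
  define P where "P = density torus (\<lambda>_. ennreal (1 / (2 * pi)))"
  have P: "integrable P h \<longleftrightarrow> integrable torus h" "(LINT x|P. h x) = (LINT x|torus. h x) / (2 * pi)"
    if "continuous_on UNIV h" for h :: "real \<Rightarrow> real"
  proof -
    have "h \<in> borel_measurable torus"
      using borel_measurable_continuous_onI[OF that] by measurable
    then show "integrable P h \<longleftrightarrow> integrable torus h" "(LINT x|P. h x) = (LINT x|torus. h x) / (2 * pi)"
      using integrable_torus_continuous[OF that]
      unfolding P_def by (simp_all add: integrable_density integral_density)
  qed
  interpret P: prob_space P
    by (rule prob_spaceI)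
      (simp add: P_def emeasure_density emeasure_torus nn_integral_cmult space_density flip: ennreal_mult')
  have c: "continuous_on UNIV (\<lambda>x. 2 + m\<^sup>2 * (f x)\<^sup>2)" "continuous_on UNIV (\<lambda>x. exp (sqrt (2 + m\<^sup>2 * (f x)\<^sup>2)))"
    "continuous_on UNIV (\<lambda>x. (f x)\<^sup>2)" "continuous_on UNIV (\<lambda>x. exp (m * f x))"
    by (intro continuous_intros f)+
  \<comment> \<open>Undoes the shift after Jensen: the integrand becomes linear in \<open>f\<close>
    again, and the additive 2 is the source of \<open>exp 2\<close>.\<close>
  have le: "sqrt (2 + m\<^sup>2 * (f x)\<^sup>2) \<le> 2 + m * f x" for x
    using m f(2)[of x] by (intro real_le_lsqrt) (auto simp: power2_sum power_mult_distrib)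
  have "m * sqrt ((LINT x|torus. (f x)\<^sup>2) / (2 * pi)) = sqrt (m\<^sup>2 * ((LINT x|torus. (f x)\<^sup>2) / (2 * pi)))"
    using m by (simp only: real_sqrt_mult real_sqrt_abs abs_of_nonneg)
  also have "\<dots> \<le> sqrt (2 + m\<^sup>2 * ((LINT x|torus. (f x)\<^sup>2) / (2 * pi)))"
    by simp
  also have "2 + m\<^sup>2 * ((LINT x|torus. (f x)\<^sup>2) / (2 * pi)) = (LINT x|P. 2 + m\<^sup>2 * (f x)\<^sup>2)"
    using c(3) by (subst Bochner_Integration.integral_add)
      (auto simp: P integrable_torus_continuous P.prob_space)
  finally have "exp (m * sqrt ((LINT x|torus. (f x)\<^sup>2) / (2 * pi))) \<le> exp (sqrt (LINT x|P. 2 + m\<^sup>2 * (f x)\<^sup>2))"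
    by simp
  also have "\<dots> \<le> (LINT x|P. exp (sqrt (2 + m\<^sup>2 * (f x)\<^sup>2)))"
    by (rule P.jensens_inequality[OF _ _ _ _ convex_exp_sqrt])
      (auto simp: P c integrable_torus_continuous add_pos_nonneg less_le_trans[of 1 2])
  also have "\<dots> = (LINT x|torus. exp (sqrt (2 + m\<^sup>2 * (f x)\<^sup>2))) / (2 * pi)"
    by (simp add: P c)
  also have "\<dots> \<le> (LINT x|torus. exp 2 * exp (m * f x)) / (2 * pi)"
    using le by (intro divide_right_mono integral_mono integrable_torus_continuous continuous_intros f)
      (auto simp flip: exp_add)
  finally show ?thesis
    by simp
qed

text \<open>Two of the four factors are bounded in sup norm by \<open>norm_trig_square_le\<close>,
  the other two are integrated by Parseval.\<close>

lemma trig_power4_le: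
  assumes A: "finite A" and r: "2 * pi * (\<Sum>n\<in>A. (cmod (c n))\<^sup>2) \<le> r"
  shows "(LINT x|torus. cmod (trig A c x) ^ 4) \<le> real (card A) * r\<^sup>2 / (2 * pi)"
proof -
  let ?S = "\<Sum>n\<in>A. (cmod (c n))\<^sup>2"
  have S: "0 \<le> ?S" by (simp add: sum_nonneg)
  have "(LINT x|torus. cmod (trig A c x) ^ 4) \<le> (LINT x|torus. real (card A) * ?S * (cmod (trig A c x))\<^sup>2)"
  proof (intro integral_mono integrable_torus_continuous continuous_intros)
    fix x
    show "cmod (trig A c x) ^ 4 \<le> real (card A) * ?S * (cmod (trig A c x))\<^sup>2"
      using mult_right_mono[OF norm_trig_square_le[OF A, of c x], of "(cmod (trig A c x))\<^sup>2"]
      by (simp add: power2_eq_square eval_nat_numeral mult.assoc)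
  qed
  also have "\<dots> = real (card A) * (2 * pi * ?S)\<^sup>2 / (2 * pi)"
    by (simp add: parseval_trig[OF A]) (simp add: power2_eq_square)
  also have "\<dots> \<le> real (card A) * r\<^sup>2 / (2 * pi)"
    using S r by (intro divide_right_mono mult_left_mono power_mono) auto
  finally show ?thesis .
qed

text \<open>The quartic integral \<open>I\<close> is \<open>sqrt I * sqrt I\<close>. One factor is
  replaced by its deterministic bound from \<open>trig_power4_le\<close>; the other goes into
  \<open>exp_sqrt_integral_le\<close> with the squared modulus as \<open>f\<close>. The new exponent
  is quadratic in the coefficients, hence within reach of Gaussian integrability.\<close>

lemma exp_trig_power4_le:
  assumes A: "finite A" "real (card A) \<le> k" and r: "2 * pi * (\<Sum>n\<in>A. (cmod (c n))\<^sup>2) \<le> r" and v: "0 \<le> v"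
  shows "exp (v * (LINT x|torus. cmod (trig A c x) ^ 4)) \<le>
    exp 2 / (2 * pi) * (LINT x|torus. exp (v * r * sqrt k * (cmod (trig A c x))\<^sup>2))"
proof -
  define I where "I = (LINT x|torus. cmod (trig A c x) ^ 4)"
  have I: "0 \<le> I"
    unfolding I_def by (intro integral_nonneg_AE) auto
  have k: "0 \<le> k"
    using A(2) by (rule order_trans[rotated]) simp
  have "0 \<le> 2 * pi * (\<Sum>n\<in>A. (cmod (c n))\<^sup>2)"
    by (simp add: sum_nonneg)
  with r have r0: "0 \<le> r" by linarith
  have "I \<le> real (card A) * r\<^sup>2 / (2 * pi)"
    unfolding I_def by (rule trig_power4_le[OF A(1) r])
  also have "\<dots> \<le> k * r\<^sup>2 / (2 * pi)"
    using A(2) by (intro divide_right_mono mult_right_mono) auto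
  finally have "sqrt I \<le> sqrt (k * r\<^sup>2 / (2 * pi))"
    by simp
  then have "sqrt I * sqrt I \<le> sqrt (k * r\<^sup>2 / (2 * pi)) * sqrt I"
    using I by (intro mult_right_mono) auto
  \<comment> \<open>The factor \<open>2 * pi\<close> moves under the other root, where it turns the
    integral into a mean.\<close>
  also have "\<dots> = r * sqrt k * sqrt (I / (2 * pi))"
    using r0 by (simp add: real_sqrt_mult real_sqrt_divide)
  finally have "I \<le> r * sqrt k * sqrt (I / (2 * pi))"
    using I by simp
  then have "exp (v * I) \<le> exp (v * r * sqrt k * sqrt (I / (2 * pi)))"
    using mult_left_mono[OF _ v] by (fastforce simp: mult.assoc)
  also have "\<dots> = exp (v * r * sqrt k * sqrt ((LINT x|torus. ((cmod (trig A c x))\<^sup>2)\<^sup>2) / (2 * pi)))"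
    by (simp add: I_def)
  also have "\<dots> \<le> exp 2 / (2 * pi) * (LINT x|torus. exp (v * r * sqrt k * (cmod (trig A c x))\<^sup>2))"
    using v r0 k by (intro exp_sqrt_integral_le continuous_intros) auto
  finally show ?thesis
    by (simp add: I_def)
qed

text \<open>By Fubini the expectation may be taken at a fixed point \<open>x\<close>. There the
  polynomial is a Gaussian sum whose coefficients differ from \<open>a n\<close> by unimodular
  phases, so the bound is the same for every \<open>x\<close>.\<close>

lemma (in prob_space) nn_integral_exp_trig_le:
  assumes g: "iid_std_complex_gaussian M g" and A: "finite A"
    and m: "0 \<le> m" "m * (\<Sum>n\<in>A. (cmod (a n))\<^sup>2) \<le> 1 / 4"
  shows "(\<integral>\<^sup>+\<omega>. ennreal (LINT x|torus. exp (m * (cmod (trig A (\<lambda>n. a n * g n \<omega>) x))\<^sup>2)) \<partial>M) \<le> ennreal (2 * pi * sqrt 2)"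
proof -
  note [measurable] = iid_std_complex_gaussian_measurable[OF g]
  interpret P: pair_sigma_finite torus M
    by unfold_locales
  have "(\<integral>\<^sup>+\<omega>. ennreal (LINT x|torus. exp (m * (cmod (trig A (\<lambda>n. a n * g n \<omega>) x))\<^sup>2)) \<partial>M) =
      (\<integral>\<^sup>+\<omega>. \<integral>\<^sup>+x. ennreal (exp (m * (cmod (trig A (\<lambda>n. a n * g n \<omega>) x))\<^sup>2)) \<partial>torus \<partial>M)"
    by (intro nn_integral_cong nn_integral_eq_integral[symmetric] integrable_torus_continuous continuous_intros) auto
  also have "\<dots> = (\<integral>\<^sup>+x. \<integral>\<^sup>+\<omega>. ennreal (exp (m * (cmod (trig A (\<lambda>n. a n * g n \<omega>) x))\<^sup>2)) \<partial>M \<partial>torus)"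
    by (rule P.Fubini') (unfold trig_def, measurable)
  also have "\<dots> \<le> (\<integral>\<^sup>+x. ennreal (sqrt 2) \<partial>torus)"
  proof (rule nn_integral_mono)
    fix x
    have "trig A (\<lambda>n. a n * g n \<omega>) x = (\<Sum>n\<in>A. (a n * exp (\<i> * of_int n * of_real x)) * g n \<omega>)" for \<omega>
      by (simp add: trig_def ac_simps)
    moreover have "cmod (exp (\<i> * of_int n * of_real x)) = 1" for n
      by simp
    ultimately show "(\<integral>\<^sup>+\<omega>. ennreal (exp (m * (cmod (trig A (\<lambda>n. a n * g n \<omega>) x))\<^sup>2)) \<partial>M) \<le> ennreal (sqrt 2)"
      using iid_std_complex_gaussian_exp_norm_square[OF g A m(1), of "\<lambda>n. a n * exp (\<i> * of_int n * of_real x)"] m(2)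
      by (simp add: norm_mult)
  qed
  also have "\<dots> = ennreal (2 * pi * sqrt 2)"
    by (simp add: emeasure_torus mult.commute ennreal_mult flip: ennreal_mult'')
  finally show ?thesis .
qed

section \<open>Dyadic blocks\<close>

text \<open>Because of the shift by \<open>Suc\<close>, block \<open>j\<close> consists of the
  frequencies with \<open>2^j \<le> |n| + 1 < 2^(j+1)\<close>; frequency zero is covered and forms
  block 0 alone.\<close>

definition dyadic_block :: "nat \<Rightarrow> nat \<Rightarrow> int set" where
  "dyadic_block N j = {n \<in> {- int N..int N}. floor_log (Suc (nat \<bar>n\<bar>)) = j}"

lemma finite_dyadic_block [simp]: "finite (dyadic_block N j)"
  by (rule finite_subset[of _ "{- int N..int N}"]) (auto simp: dyadic_block_def)

lemma dyadic_block_bounds: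
  assumes "n \<in> dyadic_block N j"
  shows "2 ^ j \<le> Suc (nat \<bar>n\<bar>)" "Suc (nat \<bar>n\<bar>) < 2 * 2 ^ j"
  using assms floor_log_exp2_le[of "Suc (nat \<bar>n\<bar>)"] floor_log_exp2_gt[of "Suc (nat \<bar>n\<bar>)"]
  by (auto simp: dyadic_block_def)

text \<open>\<open>Suc |n|\<close> takes at most \<open>2^j\<close> values on the block, each from
  at most two frequencies of opposite sign.\<close>

lemma card_dyadic_block: "real (card (dyadic_block N j)) \<le> 2 * 2 ^ j"
proof -
  let ?I = "{2 ^ j..<2 * 2 ^ j} :: nat set"
  have "n \<in> (\<lambda>k. int k - 1) ` ?I \<union> (\<lambda>k. 1 - int k) ` ?I" if "n \<in> dyadic_block N j" for n
  proof (cases "0 \<le> n")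
    case True
    then have "n = int (Suc (nat \<bar>n\<bar>)) - 1" by simp
    then show ?thesis
      using dyadic_block_bounds[OF that] by (intro UnI1 image_eqI[of _ _ "Suc (nat \<bar>n\<bar>)"]) auto
  next
    case False
    then have "n = 1 - int (Suc (nat \<bar>n\<bar>))" by simp
    then show ?thesis
      using dyadic_block_bounds[OF that] by (intro UnI2 image_eqI[of _ _ "Suc (nat \<bar>n\<bar>)"]) auto
  qed
  then have "card (dyadic_block N j) \<le> card ((\<lambda>k. int k - 1) ` ?I \<union> (\<lambda>k. 1 - int k) ` ?I)"
    by (intro card_mono) auto
  also have "\<dots> \<le> card ?I + card ?I"
    by (intro order_trans[OF card_Un_le] add_mono card_image_le) auto
  also have "\<dots> = 2 * 2 ^ j"
    by simp
  finally have "real (card (dyadic_block N j)) \<le> real (2 * 2 ^ j)"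
    by (rule of_nat_mono)
  then show ?thesis
    by simp
qed

text \<open>The crude range of block indices suffices because \<open>j < 2^j \<le> Suc |n|\<close>;
  the surplus blocks are empty.\<close>

lemma sum_dyadic_blocks:
  "(\<Sum>j\<in>{..N}. \<Sum>n\<in>dyadic_block N j. f n) = (\<Sum>n\<in>{- int N..int N}. f n)"
  unfolding dyadic_block_def
proof (rule sum.group)
  show "(\<lambda>n. floor_log (Suc (nat \<bar>n\<bar>))) ` {- int N..int N} \<subseteq> {..N}"
  proof clarsimp
    fix n :: int assume n: "- int N \<le> n" "n \<le> int N"
    have "2 ^ floor_log (Suc (nat \<bar>n\<bar>)) \<le> Suc (nat \<bar>n\<bar>)"
      by (rule floor_log_exp2_le) simp
    moreover have "floor_log (Suc (nat \<bar>n\<bar>)) < 2 ^ floor_log (Suc (nat \<bar>n\<bar>))"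
      by (rule less_exp)
    moreover have "nat \<bar>n\<bar> \<le> N"
      using n by auto
    ultimately show "floor_log (Suc (nat \<bar>n\<bar>)) \<le> N"
      by linarith
  qed
qed auto

lemma trig_dyadic_blocks: "trig {- int N..int N} c x = (\<Sum>j\<in>{..N}. trig (dyadic_block N j) c x)"
  by (simp add: trig_def sum_dyadic_blocks)

text \<open>On the block \<open>2^j\<close> is at most \<open>2 * max 1 |n|\<close>, so each weight
  is at most a constant times \<open>2^(-s j)\<close>; the maximum with 1 takes care of frequency
  zero. The remaining factor counts frequencies.\<close>

lemma sum_weight_dyadic_block:
  assumes s: "0 \<le> s"
  shows "(\<Sum>n\<in>dyadic_block N j. 1 / (1 + \<bar>real_of_int n\<bar> powr s)) \<le> 2 * 2 ^ j * (2 powr s / (2 powr s) ^ j)"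
proof -
  have "1 / (1 + \<bar>real_of_int n\<bar> powr s) \<le> 2 powr s / (2 powr s) ^ j" if n: "n \<in> dyadic_block N j" for n
  proof -
    let ?m = "\<bar>real_of_int n\<bar>"
    have "real (2 ^ j) \<le> real (Suc (nat \<bar>n\<bar>))"
      using dyadic_block_bounds(1)[OF n] by (rule of_nat_mono)
    then have "2 ^ j \<le> ?m + 1"
      by simp
    also have "\<dots> \<le> 2 * max 1 ?m"
      by auto
    finally have "(2 ^ j) powr s \<le> (2 * max 1 ?m) powr s"
      using s by (intro powr_mono2) auto
    also have "\<dots> = 2 powr s * max 1 ?m powr s"
      by (simp add: powr_mult)
    also have "\<dots> \<le> 2 powr s * (1 + ?m powr s)"
      by (intro mult_left_mono) (auto simp: max_def)
    finally have "(2 powr s) ^ j \<le> 2 powr s * (1 + ?m powr s)"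
      by (simp add: powr_power powr_powr mult.commute flip: powr_realpow)
    then show ?thesis
      by (simp add: field_simps add_pos_nonneg)
  qed
  then have "(\<Sum>n\<in>dyadic_block N j. 1 / (1 + \<bar>real_of_int n\<bar> powr s)) \<le>
      (\<Sum>n\<in>dyadic_block N j. 2 powr s / (2 powr s) ^ j)"
    by (intro sum_mono)
  also have "\<dots> \<le> 2 * 2 ^ j * (2 powr s / (2 powr s) ^ j)"
    using card_dyadic_block by (auto intro!: mult_right_mono simp del: times_divide_eq_right)
  finally show ?thesis .
qed

section \<open>Exponential moments of one block and of their sum\<close>

lemma measurable_integral_trig_power [measurable]:
  assumes [measurable]: "\<And>n. (\<lambda>\<omega>. c \<omega> n) \<in> borel_measurable M"
  shows "(\<lambda>\<omega>. LINT x|torus. cmod (trig A (c \<omega>) x) ^ k) \<in> borel_measurable M"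
proof -
  have "(\<lambda>(\<omega>, x). cmod (trig A (c \<omega>) x) ^ k) \<in> borel_measurable (M \<Otimes>\<^sub>M torus)"
    unfolding trig_def by measurable
  then show ?thesis
    by (rule torus.borel_measurable_lebesgue_integral)
qed

text \<open>The event \<open>E\<close> serves only to justify the pointwise passage to a quadratic
  exponent with deterministic factor \<open>r\<close>. After that the indicator is dropped and the
  full Gaussian expectation is bounded; the factors \<open>2 * pi\<close> cancel.\<close>

lemma (in prob_space) block_expectation_bound:
  assumes g: "iid_std_complex_gaussian M g" and A: "finite A" "real (card A) \<le> k"
    and r: "0 \<le> r" and v: "0 \<le> v" "v * r * sqrt k * (\<Sum>n\<in>A. (cmod (a n))\<^sup>2) \<le> 1 / 4"
    and E: "\<And>\<omega>. \<omega> \<in> E \<Longrightarrow> 2 * pi * (\<Sum>n\<in>A. (cmod (a n * g n \<omega>))\<^sup>2) \<le> r"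
  shows "(\<integral>\<^sup>+\<omega>. indicator E \<omega> * ennreal (exp (v * (LINT x|torus. cmod (trig A (\<lambda>n. a n * g n \<omega>) x) ^ 4))) \<partial>M)
    \<le> ennreal (exp 2 * sqrt 2)"
proof -
  have k: "0 \<le> k"
    using A(2) by (rule order_trans[rotated]) simp
  define m where "m = v * r * sqrt k"
  have m: "0 \<le> m" "m * (\<Sum>n\<in>A. (cmod (a n))\<^sup>2) \<le> 1 / 4"
    using v r k by (auto simp: m_def)
  let ?J = "\<lambda>\<omega>. LINT x|torus. exp (m * (cmod (trig A (\<lambda>n. a n * g n \<omega>) x))\<^sup>2)"
  note [measurable] = iid_std_complex_gaussian_measurable[OF g]
  have meas: "(\<lambda>\<omega>. ennreal (?J \<omega>)) \<in> borel_measurable M"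
  proof -
    have "(\<lambda>(\<omega>, x). exp (m * (cmod (trig A (\<lambda>n. a n * g n \<omega>) x))\<^sup>2)) \<in> borel_measurable (M \<Otimes>\<^sub>M torus)"
      unfolding trig_def by measurable
    then show ?thesis
      by (intro measurable_compose[OF torus.borel_measurable_lebesgue_integral]) auto
  qed
  have "(\<integral>\<^sup>+\<omega>. indicator E \<omega> * ennreal (exp (v * (LINT x|torus. cmod (trig A (\<lambda>n. a n * g n \<omega>) x) ^ 4))) \<partial>M)
      \<le> (\<integral>\<^sup>+\<omega>. ennreal (exp 2 / (2 * pi)) * ennreal (?J \<omega>) \<partial>M)"
  proof (rule nn_integral_mono)
    fix \<omega>
    show "indicator E \<omega> * ennreal (exp (v * (LINT x|torus. cmod (trig A (\<lambda>n. a n * g n \<omega>) x) ^ 4)))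
        \<le> ennreal (exp 2 / (2 * pi)) * ennreal (?J \<omega>)"
    proof (cases "\<omega> \<in> E")
      case True
      then show ?thesis
        using exp_trig_power4_le[OF A E v(1)]
        by (simp add: m_def ennreal_leI flip: ennreal_mult')
    qed simp
  qed
  also have "\<dots> = ennreal (exp 2 / (2 * pi)) * (\<integral>\<^sup>+\<omega>. ennreal (?J \<omega>) \<partial>M)"
    by (rule nn_integral_cmult) (rule meas)
  also have "\<dots> \<le> ennreal (exp 2 / (2 * pi)) * ennreal (2 * pi * sqrt 2)"
    by (intro mult_left_mono nn_integral_exp_trig_le[OF g A(1) m]) auto
  also have "\<dots> = ennreal (exp 2 * sqrt 2)"
    by (simp flip: ennreal_mult')
  finally show ?thesis .
qed

text \<open>Uniformity in \<open>N\<close>: every block obeys the same bound \<open>B\<close>, and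
  the blocks are averaged with weights of total mass 1.\<close>

lemma (in prob_space) truncated_expectation_bound:
  assumes g: "iid_std_complex_gaussian M g" and \<alpha>: "3 / 4 < \<alpha>" and r: "0 \<le> r" and L: "0 \<le> L"
    and a: "\<And>n. (cmod (a n))\<^sup>2 = 1 / (1 + \<bar>real_of_int n\<bar> powr (2 * \<alpha>))"
  shows "\<exists>B\<ge>0. \<forall>N. (\<integral>\<^sup>+\<omega>. indicator {\<omega>. 2 * pi * (\<Sum>n\<in>{- int N..int N}. (cmod (a n * g n \<omega>))\<^sup>2) \<le> r} \<omega> *
    ennreal (exp (L * (LINT x|torus. cmod (trig {- int N..int N} (\<lambda>n. a n * g n \<omega>) x) ^ 4))) \<partial>M) \<le> ennreal B"
proof -
  define s where "s = 2 * \<alpha>"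
  \<comment> \<open>\<open>\<kappa> ^ j\<close> is the decay of the root of the block size times the
    block variance, namely \<open>2^(j/2) * 2^j / 2^(s j)\<close>. It is below 1 because
    \<open>s > 3/2\<close>, that is, \<open>\<alpha> > 3/4\<close>.\<close>
  define \<kappa> where "\<kappa> = 2 * sqrt 2 / 2 powr s"
  \<comment> \<open>An eighth root of \<open>\<kappa>\<close>: weights of size
    \<open>\<rho> ^ j\<close> cost \<open>\<rho> ^ (-4 j)\<close>, which uses up only half of the
    decay.\<close>
  define \<rho> where "\<rho> = sqrt (sqrt (sqrt \<kappa>))"
  \<comment> \<open>The constant in front of the quartic integral of block \<open>j\<close> after
    recombination; \<open>(1 - \<rho>) * \<rho> ^ j\<close> is a lower bound, free of
    \<open>N\<close>, for the weight of that block.\<close>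
  define \<nu> where "\<nu> j = L / ((1 - \<rho>) * \<rho> ^ j) ^ 4" for j :: nat
  define C where "C = L / (1 - \<rho>) ^ 4 * r * sqrt 2 * 2 * 2 powr s"
  define E where "E N = {\<omega>. 2 * pi * (\<Sum>n\<in>{- int N..int N}. (cmod (a n * g n \<omega>))\<^sup>2) \<le> r}" for N
  define I where "I A \<omega> = (LINT x|torus. cmod (trig A (\<lambda>n. a n * g n \<omega>) x) ^ 4)" for A \<omega>
  have s: "0 \<le> s" "3 / 2 < s"
    using \<alpha> by (auto simp: s_def)
  have "2 * sqrt 2 = 2 powr (1 + 1 / 2)"
    by (subst powr_add) (simp add: powr_half_sqrt)
  also have "\<dots> < 2 powr s"
    using s by (intro powr_less_mono) auto
  finally have \<kappa>: "0 < \<kappa>" "\<kappa> < 1"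
    by (auto simp: \<kappa>_def)
  have \<rho>: "0 < \<rho>" "\<rho> < 1" "\<rho> ^ 4 = sqrt \<kappa>"
  proof -
    have "\<rho> ^ 4 = (\<rho>\<^sup>2)\<^sup>2"
      by simp
    also have "\<rho>\<^sup>2 = sqrt (sqrt \<kappa>)"
      unfolding \<rho>_def using \<kappa> by (intro real_sqrt_pow2) simp
    also have "(sqrt (sqrt \<kappa>))\<^sup>2 = sqrt \<kappa>"
      using \<kappa> by (intro real_sqrt_pow2) simp
    finally show "\<rho> ^ 4 = sqrt \<kappa>" .
  qed (use \<kappa> in \<open>auto simp: \<rho>_def\<close>)
  have \<nu>: "0 \<le> \<nu> j" for j
    using L \<rho> by (auto simp: \<nu>_def)
  have I0: "0 \<le> I A \<omega>" for A \<omega>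
    unfolding I_def by (intro integral_nonneg_AE) auto
  note [measurable] = iid_std_complex_gaussian_measurable[OF g]
  have [measurable]: "I A \<in> borel_measurable M" for A
    unfolding I_def[abs_def] by measurable
  have [measurable]: "(\<lambda>\<omega>. indicator (E N) \<omega> :: ennreal) \<in> borel_measurable M" for N
    unfolding E_def indicator_def mem_Collect_eq by measurable

  \<comment> \<open>The quantity that \<open>block_expectation_bound\<close> requires to be at most
    1/4, with the block size and the block variance replaced by their bounds.\<close>
  have decay: "\<nu> j * r * sqrt (2 * 2 ^ j) * (2 * 2 ^ j * (2 powr s / (2 powr s) ^ j)) = C * sqrt \<kappa> ^ j" for j
  proof -
    have "\<nu> j = L / (1 - \<rho>) ^ 4 / sqrt \<kappa> ^ j"
      unfolding \<rho>(3)[symmetric] by (simp add: \<nu>_def power_mult_distrib power_commutes flip: power_mult)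
        (simp add: mult.commute)
    moreover have "sqrt (2 * 2 ^ j) = sqrt 2 * sqrt 2 ^ j"
      by (simp add: real_sqrt_mult real_sqrt_power)
    ultimately have "\<nu> j * r * sqrt (2 * 2 ^ j) * (2 * 2 ^ j * (2 powr s / (2 powr s) ^ j)) =
        C * (2 ^ j * sqrt 2 ^ j / (2 powr s) ^ j) / sqrt \<kappa> ^ j"
      by (simp add: C_def ac_simps)
    also have "2 ^ j * sqrt 2 ^ j / (2 powr s) ^ j = \<kappa> ^ j"
      unfolding \<kappa>_def by (simp only: power_divide power_mult_distrib)
    also have "\<kappa> ^ j = sqrt \<kappa> ^ j * sqrt \<kappa> ^ j"
      using \<kappa> by (simp flip: power_mult_distrib)
    finally show ?thesis
      using \<kappa> by simp
  qed
  have "(\<lambda>j. C * sqrt \<kappa> ^ j) \<longlonglongrightarrow> C * 0"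
    using \<kappa> by (intro tendsto_mult_left LIMSEQ_realpow_zero) auto
  then have "eventually (\<lambda>j. C * sqrt \<kappa> ^ j < 1 / 4) sequentially"
    by (rule order_tendstoD) simp
  then obtain J where J: "\<And>j. J \<le> j \<Longrightarrow> C * sqrt \<kappa> ^ j < 1 / 4"
    by (auto simp: eventually_sequentially)
  \<comment> \<open>The first term serves the blocks from \<open>J\<close> on, where the Gaussian
    estimate applies. The sum dominates the deterministic bound of each of the finitely many earlier
    blocks.\<close>
  define B where "B = exp 2 * sqrt 2 + (\<Sum>j<J. exp (\<nu> j * (2 * 2 ^ j * r\<^sup>2 / (2 * pi))))"
  have B: "0 \<le> B"
    by (auto simp: B_def intro!: add_nonneg_nonneg sum_nonneg)

  have E: "2 * pi * (\<Sum>n\<in>dyadic_block N j. (cmod (a n * g n \<omega>))\<^sup>2) \<le> r" if "\<omega> \<in> E N" for N j \<omega>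
  proof -
    have "(\<Sum>n\<in>dyadic_block N j. (cmod (a n * g n \<omega>))\<^sup>2) \<le> (\<Sum>n\<in>{- int N..int N}. (cmod (a n * g n \<omega>))\<^sup>2)"
      by (intro sum_mono2) (auto simp: dyadic_block_def)
    then have "2 * pi * (\<Sum>n\<in>dyadic_block N j. (cmod (a n * g n \<omega>))\<^sup>2) \<le>
        2 * pi * (\<Sum>n\<in>{- int N..int N}. (cmod (a n * g n \<omega>))\<^sup>2)"
      by (intro mult_left_mono) auto
    also have "\<dots> \<le> r"
      using that by (simp add: E_def)
    finally show ?thesis .
  qed

  have block: "(\<integral>\<^sup>+\<omega>. indicator (E N) \<omega> * ennreal (exp (\<nu> j * I (dyadic_block N j) \<omega>)) \<partial>M) \<le> ennreal B" for N j
  proof (cases "J \<le> j")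
    case True
    have "\<nu> j * r * sqrt (2 * 2 ^ j) * (\<Sum>n\<in>dyadic_block N j. (cmod (a n))\<^sup>2) \<le>
        \<nu> j * r * sqrt (2 * 2 ^ j) * (2 * 2 ^ j * (2 powr s / (2 powr s) ^ j))"
      using sum_weight_dyadic_block[OF s(1)] \<nu> r by (intro mult_left_mono) (auto simp: a s_def)
    also have "\<dots> \<le> 1 / 4"
      using J[OF True] by (simp only: decay)
    finally have "(\<integral>\<^sup>+\<omega>. indicator (E N) \<omega> * ennreal (exp (\<nu> j * I (dyadic_block N j) \<omega>)) \<partial>M) \<le> ennreal (exp 2 * sqrt 2)"
      unfolding I_def using E by (intro block_expectation_bound[OF g finite_dyadic_block card_dyadic_block r \<nu>]) auto
    also have "\<dots> \<le> ennreal B"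
      by (intro ennreal_leI) (simp add: B_def sum_nonneg)
    finally show ?thesis .
  next
    case False
    have "indicator (E N) \<omega> * ennreal (exp (\<nu> j * I (dyadic_block N j) \<omega>)) \<le> ennreal B" for \<omega>
    proof (cases "\<omega> \<in> E N")
      case True
      have "I (dyadic_block N j) \<omega> \<le> real (card (dyadic_block N j)) * r\<^sup>2 / (2 * pi)"
        unfolding I_def by (rule trig_power4_le[OF finite_dyadic_block E[OF True]])
      also have "\<dots> \<le> 2 * 2 ^ j * r\<^sup>2 / (2 * pi)"
        using card_dyadic_block by (intro divide_right_mono mult_right_mono) auto
      finally have "exp (\<nu> j * I (dyadic_block N j) \<omega>) \<le> exp (\<nu> j * (2 * 2 ^ j * r\<^sup>2 / (2 * pi)))"
        using \<nu> by (simp add: mult_left_mono del: times_divide_eq_right)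
      also have "\<dots> \<le> (\<Sum>j<J. exp (\<nu> j * (2 * 2 ^ j * r\<^sup>2 / (2 * pi))))"
        using False by (intro member_le_sum) auto
      also have "\<dots> \<le> B"
        by (simp add: B_def)
      finally show ?thesis
        using True by (simp add: ennreal_leI)
    qed simp
    then have "(\<integral>\<^sup>+\<omega>. indicator (E N) \<omega> * ennreal (exp (\<nu> j * I (dyadic_block N j) \<omega>)) \<partial>M) \<le> (\<integral>\<^sup>+\<omega>. ennreal B \<partial>M)"
      by (intro nn_integral_mono)
    then show ?thesis
      by (simp add: emeasure_space_1)
  qed

  have "(\<integral>\<^sup>+\<omega>. indicator (E N) \<omega> * ennreal (exp (L * I {- int N..int N} \<omega>)) \<partial>M) \<le> ennreal B" for N
  proof -
    \<comment> \<open>The geometric weights are normalised on a finite range that depends on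
      \<open>N\<close>, but \<open>W\<close> stays below \<open>1 / (1 - \<rho>)\<close>, which
      gives the uniform lower bound \<open>Wp\<close>.\<close>
    define W where "W = (\<Sum>j\<in>{..N}. \<rho> ^ j)"
    define p where "p j = \<rho> ^ j / W" for j
    have W: "0 < W"
      unfolding W_def using \<rho> by (intro sum_pos) auto
    have "(1 - \<rho>) * W \<le> 1"
      unfolding W_def sum_gp_basic using \<rho> by simp
    then have Wp: "(1 - \<rho>) * \<rho> ^ j \<le> p j" for j
      using mult_right_mono[of "(1 - \<rho>) * W" 1 "\<rho> ^ j"] W \<rho>
      by (simp add: p_def pos_le_divide_eq ac_simps)
    have p: "0 < p j" for j
      using W \<rho> by (simp add: p_def)
    have p1: "(\<Sum>j\<in>{..N}. p j) = 1"
      using W by (simp add: p_def W_def flip: sum_divide_distrib)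
    \<comment> \<open>Convexity is used twice. Splitting the fourth power costs
      \<open>p j ^ 3\<close>; pulling out one more \<open>p j\<close> as an averaging weight makes
      the cost \<open>p j ^ 4\<close> and lets \<open>exp\<close> pass inside the average.\<close>
    have pointwise: "exp (L * I {- int N..int N} \<omega>) \<le> (\<Sum>j\<in>{..N}. p j * exp (\<nu> j * I (dyadic_block N j) \<omega>))" for \<omega>
    proof -
      have "I {- int N..int N} \<omega> \<le>
          (LINT x|torus. (\<Sum>j\<in>{..N}. cmod (trig (dyadic_block N j) (\<lambda>n. a n * g n \<omega>) x) ^ 4 / p j ^ 3))"
        unfolding I_def trig_dyadic_blocks using p
        by (intro integral_mono integrable_torus_continuous continuous_intros cmod_power4_sum_le p1)
          (auto simp: less_imp_neq[THEN not_sym])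
      also have "\<dots> = (\<Sum>j\<in>{..N}. I (dyadic_block N j) \<omega> / p j ^ 3)"
        unfolding I_def
        by (subst Bochner_Integration.integral_sum) (auto intro!: integrable_torus_continuous continuous_intros simp: p less_imp_neq[THEN not_sym])
      finally have "L * I {- int N..int N} \<omega> \<le> L * (\<Sum>j\<in>{..N}. I (dyadic_block N j) \<omega> / p j ^ 3)"
        using L by (rule mult_left_mono)
      also have "\<dots> = (\<Sum>j\<in>{..N}. p j * (L / p j ^ 4 * I (dyadic_block N j) \<omega>))"
        unfolding sum_distrib_left
        by (intro sum.cong refl) (use p in \<open>simp add: field_simps eval_nat_numeral less_imp_neq[THEN not_sym]\<close>)
      also have "\<dots> \<le> (\<Sum>j\<in>{..N}. p j * (\<nu> j * I (dyadic_block N j) \<omega>))"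
      proof (intro sum_mono mult_left_mono mult_right_mono I0)
        fix j
        show "L / p j ^ 4 \<le> \<nu> j"
          unfolding \<nu>_def using L \<rho> p[of j] Wp[of j] by (intro divide_left_mono power_mono mult_pos_pos) auto
        show "0 \<le> p j"
          using p[of j] by simp
      qed
      finally have "exp (L * I {- int N..int N} \<omega>) \<le> exp (\<Sum>j\<in>{..N}. p j * (\<nu> j * I (dyadic_block N j) \<omega>))"
        by simp
      also have "\<dots> \<le> (\<Sum>j\<in>{..N}. p j * exp (\<nu> j * I (dyadic_block N j) \<omega>))"
        by (rule exp_sum_le[OF _ _ p p1]) auto
      finally show ?thesis .
    qed
    have "(\<integral>\<^sup>+\<omega>. indicator (E N) \<omega> * ennreal (exp (L * I {- int N..int N} \<omega>)) \<partial>M) \<le>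
        (\<integral>\<^sup>+\<omega>. (\<Sum>j\<in>{..N}. ennreal (p j) * (indicator (E N) \<omega> * ennreal (exp (\<nu> j * I (dyadic_block N j) \<omega>)))) \<partial>M)"
    proof (rule nn_integral_mono)
      fix \<omega>
      have "ennreal (exp (L * I {- int N..int N} \<omega>)) \<le> ennreal (\<Sum>j\<in>{..N}. p j * exp (\<nu> j * I (dyadic_block N j) \<omega>))"
        by (intro ennreal_leI pointwise)
      also have "\<dots> = (\<Sum>j\<in>{..N}. ennreal (p j) * ennreal (exp (\<nu> j * I (dyadic_block N j) \<omega>)))"
        using p by (subst sum_ennreal[symmetric]) (auto simp: ennreal_mult' less_imp_le intro!: mult_nonneg_nonneg)
      finally show "indicator (E N) \<omega> * ennreal (exp (L * I {- int N..int N} \<omega>)) \<le>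
          (\<Sum>j\<in>{..N}. ennreal (p j) * (indicator (E N) \<omega> * ennreal (exp (\<nu> j * I (dyadic_block N j) \<omega>))))"
        by (auto split: split_indicator)
    qed
    also have "\<dots> = (\<Sum>j\<in>{..N}. ennreal (p j) * (\<integral>\<^sup>+\<omega>. indicator (E N) \<omega> * ennreal (exp (\<nu> j * I (dyadic_block N j) \<omega>)) \<partial>M))"
      by (subst nn_integral_sum) (auto simp: nn_integral_cmult)
    also have "\<dots> \<le> (\<Sum>j\<in>{..N}. ennreal (p j) * ennreal B)"
      by (intro sum_mono mult_left_mono block) auto
    also have "\<dots> = ennreal B"
      using p p1 by (simp add: less_imp_le sum_ennreal flip: sum_distrib_right)
    finally show ?thesis .
  qed
  then show ?thesis
    using B by (auto simp: E_def I_def)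
qed

section \<open>The measurable structure of the space of square-integrable functions\<close>

definition torus_dist :: "(real \<Rightarrow> complex) \<Rightarrow> (real \<Rightarrow> complex) \<Rightarrow> real" where
  "torus_dist f h = sqrt (LINT x|torus. (cmod (f x - h x))\<^sup>2)"

lemma torus_Lp_norm_2_diff: "torus_Lp_norm 2 (\<lambda>x. f x - h x) = torus_dist f h"
  by (simp add: torus_Lp_norm_2 torus_dist_def)

lemma torus_dist_nonneg [simp]: "0 \<le> torus_dist f h"
  by (simp add: torus_dist_def integral_nonneg_AE)

lemma torus_dist_commute: "torus_dist f h = torus_dist h f"
  by (simp add: torus_dist_def norm_minus_commute)

lemma torus_dist_self [simp]: "torus_dist f f = 0"
  by (simp add: torus_dist_def)

lemma integrable_torus_norm_add_square:
  assumes "f \<in> borel_measurable borel" "h \<in> borel_measurable borel"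
    and "integrable torus (\<lambda>x. (cmod (f x))\<^sup>2)" "integrable torus (\<lambda>x. (cmod (h x))\<^sup>2)"
  shows "integrable torus (\<lambda>x. (cmod (f x + h x))\<^sup>2)"
proof (rule Bochner_Integration.integrable_bound)
  show "integrable torus (\<lambda>x. 2 * (cmod (f x))\<^sup>2 + 2 * (cmod (h x))\<^sup>2)"
    using assms by auto
  note [measurable] = assms(1,2)
  show "(\<lambda>x. (cmod (f x + h x))\<^sup>2) \<in> borel_measurable torus"
    by measurable
  have "(cmod (f x + h x))\<^sup>2 \<le> 2 * (cmod (f x))\<^sup>2 + 2 * (cmod (h x))\<^sup>2" for x
  proof -
    have "(cmod (f x + h x))\<^sup>2 \<le> (cmod (f x) + cmod (h x))\<^sup>2"
      by (intro power_mono norm_triangle_ineq) auto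
    then show ?thesis
      using sum_squares_bound[of "cmod (f x)" "cmod (h x)"] by (simp add: power2_sum)
  qed
  then show "AE x in torus. norm ((cmod (f x + h x))\<^sup>2) \<le> norm (2 * (cmod (f x))\<^sup>2 + 2 * (cmod (h x))\<^sup>2)"
    by auto
qed

lemma torus_L2_integrable_diff:
  assumes "f \<in> torus_L2" "h \<in> torus_L2"
  shows "integrable torus (\<lambda>x. (cmod (f x - h x))\<^sup>2)"
  using assms integrable_torus_norm_add_square[of f "\<lambda>x. - h x"] by (simp add: torus_L2_iff)

text \<open>Minkowski's inequality from a weighted pointwise bound:
  \<open>(a + b)^2 \<le> (1 + B/A) a^2 + (1 + A/B) b^2\<close>. When \<open>A\<close> and
  \<open>B\<close> bound the two distances, integration gives exactly
  \<open>(A + B)^2\<close>.\<close>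

lemma torus_dist_triangle:
  assumes L2: "f \<in> torus_L2" "h \<in> torus_L2" "k \<in> torus_L2"
  shows "torus_dist f k \<le> torus_dist f h + torus_dist h k"
proof (rule field_le_epsilon)
  fix e :: real assume e: "0 < e"
  \<comment> \<open>The extra \<open>e / 2\<close> keeps both weights positive when a distance
    vanishes.\<close>
  define A B where "A = torus_dist f h + e / 2" and "B = torus_dist h k + e / 2"
  have AB: "0 < A" "0 < B"
    using e by (auto simp: A_def B_def add_nonneg_pos)
  have le: "(cmod (f x - k x))\<^sup>2 \<le> (1 + B / A) * (cmod (f x - h x))\<^sup>2 + (1 + A / B) * (cmod (h x - k x))\<^sup>2" for x
  proof -
    define a b where "a = cmod (f x - h x)" and "b = cmod (h x - k x)"
    have "cmod (f x - k x) \<le> a + b"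
      unfolding a_def b_def by (rule norm_diff_triangle_ineq[of "f x" "h x" "h x" "k x", simplified])
    then have "(cmod (f x - k x))\<^sup>2 \<le> (a + b)\<^sup>2"
      by (intro power_mono) auto
    \<comment> \<open>The added square is the exact gap in the weighted inequality.\<close>
    also have "\<dots> \<le> (a + b)\<^sup>2 + (B * a - A * b)\<^sup>2 / (A * B)"
      using AB by simp
    also have "\<dots> = (1 + B / A) * a\<^sup>2 + (1 + A / B) * b\<^sup>2"
      using AB by (simp add: field_simps power2_eq_square)
    finally show ?thesis
      by (simp add: a_def b_def)
  qed
  have sq: "(LINT x|torus. (cmod (u x - v x))\<^sup>2) = (torus_dist u v)\<^sup>2" for u v
    by (simp add: torus_dist_def integral_nonneg_AE)
  have "(torus_dist f k)\<^sup>2 \<le>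
      (LINT x|torus. (1 + B / A) * (cmod (f x - h x))\<^sup>2 + (1 + A / B) * (cmod (h x - k x))\<^sup>2)"
    unfolding sq[symmetric] using L2 le
    by (intro integral_mono Bochner_Integration.integrable_add integrable_mult_right torus_L2_integrable_diff)
  also have "\<dots> = (1 + B / A) * (torus_dist f h)\<^sup>2 + (1 + A / B) * (torus_dist h k)\<^sup>2"
    using L2 by (simp add: torus_L2_integrable_diff sq)
  also have "\<dots> \<le> (1 + B / A) * A\<^sup>2 + (1 + A / B) * B\<^sup>2"
    using AB e by (intro add_mono mult_left_mono power_mono) (auto simp: A_def B_def)
  also have "\<dots> = (A + B)\<^sup>2"
    using AB by (simp add: field_simps power2_eq_square)
  finally have "torus_dist f k \<le> A + B"
    by (rule power2_le_imp_le) (use AB in simp)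
  then show "torus_dist f k \<le> torus_dist f h + torus_dist h k + e"
    by (simp add: A_def B_def)
qed

lemma torus_dist_trig:
  "finite A \<Longrightarrow> torus_dist (trig A c) (trig A d) = sqrt (2 * pi * (\<Sum>n\<in>A. (cmod (c n - d n))\<^sup>2))"
  by (simp add: torus_dist_def trig_diff parseval_trig)

lemma torus_L2_openD:
  assumes "torus_L2_open U" "f \<in> U"
  obtains e where "0 < e" "\<And>h. h \<in> torus_L2 \<Longrightarrow> torus_dist h f < e \<Longrightarrow> h \<in> U"
  using assms unfolding torus_L2_open_def torus_Lp_norm_2_diff by blast

section \<open>Measurable maps into and out of the seminormed space\<close>

lemma space_torus_L2_borel: "space torus_L2_borel = torus_L2"
  unfolding torus_L2_borel_def by (rule space_measure_of) (auto simp: torus_L2_open_def)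

lemma torus_L2_open_sets: "torus_L2_open U \<Longrightarrow> U \<in> sets torus_L2_borel"
  unfolding torus_L2_borel_def by (subst sets_measure_of) (auto simp: torus_L2_open_def)

lemma measurable_torus_L2_borelI:
  assumes "\<And>\<omega>. \<omega> \<in> space M \<Longrightarrow> F \<omega> \<in> torus_L2"
    and "\<And>U. torus_L2_open U \<Longrightarrow> F -` U \<inter> space M \<in> sets M"
  shows "F \<in> measurable M torus_L2_borel"
  unfolding torus_L2_borel_def by (rule measurable_measure_of) (use assms in \<open>auto simp: torus_L2_open_def\<close>)

text \<open>The points of \<open>U\<close> with a margin larger than \<open>\<delta>\<close>. The
  strict inequality makes the set open, and an open \<open>U\<close> is the union of these sets over
  \<open>\<delta> = 1 / Suc m\<close>.\<close>

definition torus_shrink :: "(real \<Rightarrow> complex) set \<Rightarrow> real \<Rightarrow> (real \<Rightarrow> complex) set" where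
  "torus_shrink U \<delta> = {f \<in> torus_L2. \<exists>e>\<delta>. \<forall>h\<in>torus_L2. torus_dist h f < e \<longrightarrow> h \<in> U}"

lemma torus_L2_open_shrink: "torus_L2_open (torus_shrink U \<delta>)"
  unfolding torus_L2_open_def torus_Lp_norm_2_diff
proof (intro conjI ballI)
  fix f assume "f \<in> torus_shrink U \<delta>"
  then obtain e where f: "f \<in> torus_L2" and e: "\<delta> < e" "\<And>h. h \<in> torus_L2 \<Longrightarrow> torus_dist h f < e \<Longrightarrow> h \<in> U"
    by (auto simp: torus_shrink_def)
  show "\<exists>r>0. \<forall>h\<in>torus_L2. torus_dist h f < r \<longrightarrow> h \<in> torus_shrink U \<delta>"
  \<comment> \<open>Half of the slack pays for moving the centre; the other half keeps the new
    radius \<open>(e + \<delta>) / 2\<close> above \<open>\<delta>\<close>.\<close>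
  proof (intro exI[of _ "(e - \<delta>) / 2"] conjI ballI impI)
    fix h assume h: "h \<in> torus_L2" "torus_dist h f < (e - \<delta>) / 2"
    have "k \<in> U" if k: "k \<in> torus_L2" "torus_dist k h < (e + \<delta>) / 2" for k
    proof (rule e(2)[OF k(1)])
      have "torus_dist k f \<le> torus_dist k h + torus_dist h f"
        by (rule torus_dist_triangle[OF k(1) h(1) f])
      then show "torus_dist k f < e"
        using k(2) h(2) by (simp add: field_simps)
    qed
    moreover have "\<delta> < (e + \<delta>) / 2"
      using e(1) by simp
    ultimately show "h \<in> torus_shrink U \<delta>"
      using h(1) unfolding torus_shrink_def by blast
  qed (use e in simp)
qed (auto simp: torus_shrink_def)

text \<open>Membership of the limit in an open \<open>U\<close> is expressed by countably many
  conditions on the sequence. Eventual membership in \<open>U\<close> would not force the limit into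
  \<open>U\<close>; eventual membership with a fixed margin does.\<close>

lemma measurable_torus_L2_borel_limit:
  assumes F: "\<And>k. F k \<in> measurable M torus_L2_borel"
    and G: "\<And>\<omega>. \<omega> \<in> space M \<Longrightarrow> G \<omega> \<in> torus_L2"
    and lim: "\<And>\<omega>. \<omega> \<in> space M \<Longrightarrow> (\<lambda>k. torus_dist (F k \<omega>) (G \<omega>)) \<longlonglongrightarrow> 0"
  shows "G \<in> measurable M torus_L2_borel"
proof (rule measurable_torus_L2_borelI)
  fix U assume U: "torus_L2_open U"
  have FL2: "F k \<omega> \<in> torus_L2" if "\<omega> \<in> space M" for k \<omega>
    using measurable_space[OF F that] by (simp add: space_torus_L2_borel)
  have iff: "G \<omega> \<in> U \<longleftrightarrow> (\<exists>m K. \<forall>k\<ge>K. F k \<omega> \<in> torus_shrink U (1 / Suc m))" if \<omega>: "\<omega> \<in> space M" for \<omega>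
  proof
    assume "G \<omega> \<in> U"
    then obtain e where e: "0 < e" "\<And>h. h \<in> torus_L2 \<Longrightarrow> torus_dist h (G \<omega>) < e \<Longrightarrow> h \<in> U"
      using torus_L2_openD[OF U] by blast
    obtain m where m: "1 / Suc m < e / 2"
      using reals_Archimedean[of "e / 2"] e(1) by (auto simp: inverse_eq_divide)
    have "eventually (\<lambda>k. torus_dist (F k \<omega>) (G \<omega>) < e / 2) sequentially"
      using lim[OF \<omega>] e(1) by (intro order_tendstoD) auto
    then obtain K where K: "\<And>k. K \<le> k \<Longrightarrow> torus_dist (F k \<omega>) (G \<omega>) < e / 2"
      by (auto simp: eventually_sequentially)
    have "F k \<omega> \<in> torus_shrink U (1 / Suc m)" if "K \<le> k" for k
    proof -
      have "h \<in> U" if h: "h \<in> torus_L2" "torus_dist h (F k \<omega>) < e / 2" for h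
        using torus_dist_triangle[OF h(1) FL2[OF \<omega>, of k] G[OF \<omega>]] K[OF \<open>K \<le> k\<close>] h by (intro e(2)) auto
      then show ?thesis
        using FL2[OF \<omega>] m unfolding torus_shrink_def by blast
    qed
    then show "\<exists>m K. \<forall>k\<ge>K. F k \<omega> \<in> torus_shrink U (1 / Suc m)"
      by blast
  next
    assume "\<exists>m K. \<forall>k\<ge>K. F k \<omega> \<in> torus_shrink U (1 / Suc m)"
    then obtain m K where K: "\<And>k. K \<le> k \<Longrightarrow> F k \<omega> \<in> torus_shrink U (1 / Suc m)"
      by blast
    have "eventually (\<lambda>k. torus_dist (F k \<omega>) (G \<omega>) < 1 / Suc m) sequentially"
      using lim[OF \<omega>] by (intro order_tendstoD) auto
    then obtain k where k: "K \<le> k" "torus_dist (F k \<omega>) (G \<omega>) < 1 / Suc m"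
      by (auto simp: eventually_sequentially) (meson linear order_trans)
    then show "G \<omega> \<in> U"
      using K[OF k(1)] G[OF \<omega>] by (force simp: torus_shrink_def torus_dist_commute)
  qed
  have [measurable]: "{\<omega> \<in> space M. F k \<omega> \<in> torus_shrink U (1 / Suc m)} \<in> sets M" for k m
    using measurable_sets[OF F torus_L2_open_sets[OF torus_L2_open_shrink]]
    by (simp add: vimage_def Int_def conj_commute)
  have "{\<omega> \<in> space M. \<exists>m K. \<forall>k\<ge>K. F k \<omega> \<in> torus_shrink U (1 / Suc m)} \<in> sets M"
    by measurable
  also have "{\<omega> \<in> space M. \<exists>m K. \<forall>k\<ge>K. F k \<omega> \<in> torus_shrink U (1 / Suc m)} = G -` U \<inter> space M"
    using iff by blast
  finally show "G -` U \<inter> space M \<in> sets M" .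
qed (rule G)

text \<open>By Parseval the polynomial depends continuously on its coefficients in the product
  topology, as only finitely many coordinates enter. Coordinatewise measurability of the
  coefficients then suffices.\<close>

lemma measurable_trig_torus_L2_borel:
  assumes A: "finite A" and c: "\<And>n. (\<lambda>\<omega>. c \<omega> n) \<in> borel_measurable M"
  shows "(\<lambda>\<omega>. trig A (c \<omega>)) \<in> measurable M torus_L2_borel"
proof (rule measurable_torus_L2_borelI)
  fix U assume U: "torus_L2_open U"
  have "open {c. trig A c \<in> U}"
  proof (subst open_subopen, safe)
    fix c assume "trig A c \<in> U"
    then obtain e where e: "0 < e" "\<And>h. h \<in> torus_L2 \<Longrightarrow> torus_dist h (trig A c) < e \<Longrightarrow> h \<in> U"
      using torus_L2_openD[OF U] by blast
    let ?T = "{d. sqrt (2 * pi * (\<Sum>n\<in>A. (cmod (d n - c n))\<^sup>2)) < e}"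
    have "open ?T"
      by (intro open_Collect_less continuous_intros continuous_on_product_coordinates)
    moreover have "c \<in> ?T"
      using e(1) by simp
    moreover have "?T \<subseteq> {c. trig A c \<in> U}"
      using e(2) by (auto simp: torus_dist_trig[OF A] trig_L2)
    ultimately show "\<exists>T. open T \<and> c \<in> T \<and> T \<subseteq> {c. trig A c \<in> U}"
      by blast
  qed
  moreover have "c \<in> borel_measurable M"
    by (rule measurable_coordinatewise_then_product) (rule c)
  ultimately have "c -` {c. trig A c \<in> U} \<inter> space M \<in> sets M"
    by (intro measurable_sets[of c M borel]) auto
  then show "(\<lambda>\<omega>. trig A (c \<omega>)) -` U \<inter> space M \<in> sets M"
    by (simp add: vimage_def)
qed (rule trig_L2)

text \<open>Lipschitz continuity of the coefficients: the difference is bounded by the mean of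
  \<open>|f - h|\<close>, and Cauchy-Schwarz bounds that mean.\<close>

lemma torus_fourier_coeff_dist:
  assumes L2: "f \<in> torus_L2" "h \<in> torus_L2"
  shows "cmod (torus_fourier_coeff f n - torus_fourier_coeff h n) \<le> torus_dist f h"
proof -
  have meas [measurable]: "f \<in> borel_measurable borel" "h \<in> borel_measurable borel"
    using L2 by (auto simp: torus_L2_iff)
  have int1: "integrable torus u" if "u \<in> borel_measurable borel" "integrable torus (\<lambda>x. (cmod (u x))\<^sup>2)"
    for u :: "real \<Rightarrow> complex"
  proof (rule Bochner_Integration.integrable_bound)
    show "integrable torus (\<lambda>x. 1 + (cmod (u x))\<^sup>2)"
      using that by simp
    show "u \<in> borel_measurable torus"
      using that(1) by measurable
    have "cmod (u x) \<le> 1 + (cmod (u x))\<^sup>2" for x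
      using sum_squares_bound[of 1 "cmod (u x)"] by (simp add: add_increasing2 order_trans[rotated])
    then show "AE x in torus. norm (u x) \<le> norm (1 + (cmod (u x))\<^sup>2)"
      by auto
  qed
  have inte: "integrable torus (\<lambda>x. u x * exp (- (\<i> * of_int n * of_real x)))" if "u \<in> torus_L2" for u
    using that by (intro int1) (auto simp: torus_L2_iff norm_mult)
  define w where "w x = cmod (f x - h x)" for x
  have w2: "integrable torus (\<lambda>x. (w x)\<^sup>2)"
    unfolding w_def by (rule torus_L2_integrable_diff[OF L2])
  have w1: "integrable torus w"
    unfolding w_def by (intro integrable_norm int1 torus_L2_integrable_diff[OF L2]) measurable
  define J where "J = (LINT x|torus. w x)"
  have J: "0 \<le> J"
    unfolding J_def w_def by (intro integral_nonneg_AE) auto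
  \<comment> \<open>Cauchy-Schwarz in variance form: \<open>w\<close> is compared with its own
    mean.\<close>
  have "0 \<le> (LINT x|torus. (w x - J / (2 * pi))\<^sup>2)"
    by (intro integral_nonneg_AE) auto
  also have "\<dots> = (LINT x|torus. (w x)\<^sup>2 + (J / (2 * pi))\<^sup>2 - 2 * (J / (2 * pi)) * w x)"
    by (simp add: power2_diff ac_simps)
  also have "\<dots> = (LINT x|torus. (w x)\<^sup>2) + 2 * pi * (J / (2 * pi))\<^sup>2 - 2 * (J / (2 * pi)) * J"
    using w1 w2 by (simp add: J_def)
  also have "\<dots> = (LINT x|torus. (w x)\<^sup>2) - J\<^sup>2 / (2 * pi)"
    by (simp add: field_simps power2_eq_square)
  finally have "J\<^sup>2 / (2 * pi) \<le> (LINT x|torus. (w x)\<^sup>2)"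
    by simp
  \<comment> \<open>The sharp constant \<open>1 / sqrt (2 * pi)\<close> is relaxed to 1.\<close>
  moreover have "(J / (2 * pi))\<^sup>2 \<le> J\<^sup>2 / (2 * pi)"
    unfolding power_divide using pi_gt3 by (intro divide_left_mono self_le_power) auto
  ultimately have "J / (2 * pi) \<le> torus_dist f h"
    unfolding torus_dist_def w_def[symmetric] by (intro real_le_rsqrt) simp
  have "torus_fourier_coeff f n - torus_fourier_coeff h n =
      (LINT x|torus. (f x - h x) * exp (- (\<i> * of_int n * of_real x))) / (2 * of_real pi)"
    using inte L2 by (simp add: torus_fourier_coeff_eq left_diff_distrib flip: diff_divide_distrib)
  also have "cmod \<dots> \<le> J / (2 * pi)"
    unfolding J_def w_def
    using integral_norm_bound[of torus "\<lambda>x. (f x - h x) * exp (- (\<i> * of_int n * of_real x))"]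
    by (simp add: norm_divide norm_mult divide_right_mono)
  finally show ?thesis
    using \<open>J / (2 * pi) \<le> torus_dist f h\<close> by linarith
qed

lemma measurable_torus_fourier_coeff [measurable]:
  "(\<lambda>v. torus_fourier_coeff v n) \<in> borel_measurable torus_L2_borel"
proof (rule borel_measurableI)
  fix S :: "complex set" assume S: "open S"
  have "torus_L2_open {v \<in> torus_L2. torus_fourier_coeff v n \<in> S}"
    unfolding torus_L2_open_def torus_Lp_norm_2_diff
  proof (intro conjI ballI)
    fix f assume f: "f \<in> {v \<in> torus_L2. torus_fourier_coeff v n \<in> S}"
    then obtain e where e: "0 < e" "\<And>z. dist z (torus_fourier_coeff f n) < e \<Longrightarrow> z \<in> S"
      using S unfolding open_dist by blast
    show "\<exists>e>0. \<forall>h\<in>torus_L2. torus_dist h f < e \<longrightarrow> h \<in> {v \<in> torus_L2. torus_fourier_coeff v n \<in> S}"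
      using e f torus_fourier_coeff_dist[of _ f n]
      by (intro exI[of _ e]) (auto simp: dist_norm intro: le_less_trans)
  qed auto
  then show "(\<lambda>v. torus_fourier_coeff v n) -` S \<inter> space torus_L2_borel \<in> sets torus_L2_borel"
    by (auto dest!: torus_L2_open_sets simp: space_torus_L2_borel vimage_def Int_def conj_commute)
qed

text \<open>The weight sees \<open>v\<close> only through finitely many Fourier
  coefficients.\<close>

lemma measurable_truncated_weight: "truncated_weight R lam N \<in> borel_measurable torus_L2_borel"
proof -
  have m: "(\<lambda>v. LINT x|torus. cmod (fourier_proj N v x) ^ k) \<in> borel_measurable torus_L2_borel" for k
    unfolding fourier_proj_eq_trig by measurable
  note [measurable] = m[of 2] m[of 4]
  have "truncated_weight R lam N = (\<lambda>v. (if sqrt (LINT x|torus. cmod (fourier_proj N v x) ^ 2) \<le> R then 1 else 0) *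
      exp (lam * (LINT x|torus. cmod (fourier_proj N v x) ^ 4)))"
    by (auto simp: fun_eq_iff truncated_weight_def torus_Lp_norm_2 torus_Lp_norm_4_power indicator_def)
  then show ?thesis
    by simp
qed

section \<open>The Riesz-Fischer theorem\<close>

lemma torus_dist_fourier_sum:
  "torus_dist (trig {- int K..int K} c) (trig {- int K'..int K'} c) =
    sqrt (2 * pi * \<bar>(\<Sum>n\<in>{- int K..int K}. (cmod (c n))\<^sup>2) - (\<Sum>n\<in>{- int K'..int K'}. (cmod (c n))\<^sup>2)\<bar>)"
proof -
  have *: "torus_dist (trig {- int K..int K} c) (trig {- int K'..int K'} c) =
    sqrt (2 * pi * \<bar>(\<Sum>n\<in>{- int K..int K}. (cmod (c n))\<^sup>2) - (\<Sum>n\<in>{- int K'..int K'}. (cmod (c n))\<^sup>2)\<bar>)"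
    if "K' \<le> K" for K K'
  proof -
    have sub: "{- int K'..int K'} \<subseteq> {- int K..int K}"
      using that by auto
    then have "(\<Sum>n\<in>{- int K..int K}. (cmod (c n))\<^sup>2) - (\<Sum>n\<in>{- int K'..int K'}. (cmod (c n))\<^sup>2) =
        (\<Sum>n\<in>{- int K..int K} - {- int K'..int K'}. (cmod (c n))\<^sup>2)"
      by (simp add: sum_diff)
    then show ?thesis
      using sub by (simp add: torus_dist_def trig_diff_subset parseval_trig sum_nonneg)
  qed
  show ?thesis
    using *[of K' K] *[of K K'] by (cases "K' \<le> K") (auto simp: torus_dist_commute abs_minus_commute)
qed

lemma nn_integral_torus_dist:
  assumes "f \<in> torus_L2" "h \<in> torus_L2"
  shows "(\<integral>\<^sup>+x. ennreal ((cmod (f x - h x))\<^sup>2) \<partial>torus) = ennreal ((torus_dist f h)\<^sup>2)"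
  using nn_integral_eq_integral[OF torus_L2_integrable_diff[OF assms]]
  by (simp add: torus_dist_def integral_nonneg_AE)

text \<open>
  Riesz-Fischer. A subsequence of the partial sums whose tails decay geometrically converges almost
  everywhere, and Fatou's lemma identifies its limit as the sum in \<open>L\<^sup>2\<close>.
\<close>

lemma riesz_fischer:
  assumes bdd: "\<And>K::nat. (\<Sum>n\<in>{- int K..int K}. (cmod (c n))\<^sup>2) \<le> B"
  shows "\<exists>f\<in>torus_L2. (\<lambda>K. torus_dist (trig {- int K..int K} c) f) \<longlonglongrightarrow> 0"
proof -
  define s where "s K = (\<Sum>n\<in>{- int K..int K}. (cmod (c n))\<^sup>2)" for K :: nat
  have inc: "incseq s"
    unfolding s_def by (intro incseq_SucI sum_mono2) auto
  obtain S where S: "s \<longlonglongrightarrow> S" "\<And>K. s K \<le> S"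
  proof (rule incseq_convergent[OF inc])
    show "\<forall>K. s K \<le> B"
      using bdd by (simp add: s_def)
  qed blast
  have "\<exists>K. S - s K < (1 / 4) ^ j" for j :: nat
  proof -
    have "eventually (\<lambda>K. S - (1 / 4) ^ j < s K) sequentially"
      using S(1) by (rule order_tendstoD) simp
    then show ?thesis
      by (auto simp: eventually_sequentially algebra_simps)
  qed
  then obtain \<kappa> where \<kappa>: "\<And>j. S - s (\<kappa> j) < (1 / 4) ^ j"
    by metis
  define T where "T K = trig {- int K..int K} c" for K :: nat
  have T_L2: "T K \<in> torus_L2" for K
    unfolding T_def by (rule trig_L2)
  have T_dist: "(torus_dist (T K) (T K'))\<^sup>2 = 2 * pi * \<bar>s K - s K'\<bar>" for K K'
    unfolding T_def s_def torus_dist_fourier_sum by simp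
  have [measurable]: "T K \<in> borel_measurable borel" for K
    unfolding T_def by measurable
  \<comment> \<open>\<open>lim\<close> has some value even where the sequence diverges, so
    \<open>f\<close> is Borel and periodic everywhere although convergence holds only almost
    everywhere.\<close>
  define f where "f x = lim (\<lambda>j. T (\<kappa> j) x)" for x
  have [measurable]: "f \<in> borel_measurable borel"
    unfolding f_def[abs_def] by measurable

  have conv: "AE x in torus. (\<lambda>j. T (\<kappa> j) x) \<longlonglongrightarrow> f x"
  proof -
    \<comment> \<open>The squared increments have integrals of order \<open>(1/4)^j\<close>, so the
      factor \<open>2^j\<close> leaves a summable series. By the arithmetic-geometric mean
      inequality it also dominates the unsquared increments up to \<open>(1/2)^j\<close>.\<close>
    define D where "D j x = 2 ^ j * (cmod (T (\<kappa> (Suc j)) x - T (\<kappa> j) x))\<^sup>2" for j x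
    have "(\<integral>\<^sup>+x. (\<Sum>j. ennreal (D j x)) \<partial>torus) = (\<Sum>j. \<integral>\<^sup>+x. ennreal (D j x) \<partial>torus)"
      unfolding D_def by (rule nn_integral_suminf) measurable
    also have "\<dots> \<le> (\<Sum>j. ennreal (2 * pi * (1 / 2) ^ j))"
    proof (intro suminf_le summableI)
      fix j
      have "\<bar>s (\<kappa> (Suc j)) - s (\<kappa> j)\<bar> \<le> (1 / 4) ^ j"
        using \<kappa>[of j] \<kappa>[of "Suc j"] S(2)[of "\<kappa> j"] S(2)[of "\<kappa> (Suc j)"] power_decreasing[of j "Suc j" "1 / 4 :: real"]
        by auto
      then have "2 ^ j * (2 * pi * \<bar>s (\<kappa> (Suc j)) - s (\<kappa> j)\<bar>) \<le> 2 ^ j * (2 * pi * (1 / 4) ^ j)"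
        by (intro mult_left_mono) auto
      also have "\<dots> = 2 * pi * (1 / 2) ^ j"
        by (simp flip: power_mult_distrib)
      finally have "ennreal (2 ^ j * (2 * pi * \<bar>s (\<kappa> (Suc j)) - s (\<kappa> j)\<bar>)) \<le> ennreal (2 * pi * (1 / 2) ^ j)"
        by (rule ennreal_leI)
      moreover have "(\<integral>\<^sup>+x. ennreal (D j x) \<partial>torus) =
          ennreal (2 ^ j) * (\<integral>\<^sup>+x. ennreal ((cmod (T (\<kappa> (Suc j)) x - T (\<kappa> j) x))\<^sup>2) \<partial>torus)"
        unfolding D_def by (subst nn_integral_cmult[symmetric]) (auto intro!: nn_integral_cong ennreal_mult')
      moreover have "\<dots> = ennreal (2 ^ j * (2 * pi * \<bar>s (\<kappa> (Suc j)) - s (\<kappa> j)\<bar>))"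
        unfolding nn_integral_torus_dist[OF T_L2 T_L2] T_dist by (rule ennreal_mult'[symmetric]) simp
      ultimately show "(\<integral>\<^sup>+x. ennreal (D j x) \<partial>torus) \<le> ennreal (2 * pi * (1 / 2) ^ j)"
        by simp
    qed
    also have "\<dots> = ennreal (\<Sum>j. 2 * pi * (1 / 2) ^ j)"
      by (intro suminf_ennreal2 summable_mult) auto
    finally have "(\<integral>\<^sup>+x. (\<Sum>j. ennreal (D j x)) \<partial>torus) \<noteq> \<infinity>"
      by (auto simp: top_unique)
    then have "AE x in torus. (\<Sum>j. ennreal (D j x)) \<noteq> \<infinity>"
      unfolding D_def by (intro nn_integral_PInf_AE) measurable
    then show ?thesis
    proof eventually_elim
      fix x assume "(\<Sum>j. ennreal (D j x)) \<noteq> \<infinity>"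
      then have "summable (\<lambda>j. D j x)"
        by (intro summable_suminf_not_top) (auto simp: D_def)
      then have sum: "summable (\<lambda>j. (1 / 2) ^ j + D j x)"
        by (intro summable_add) auto
      have le: "cmod (T (\<kappa> (Suc j)) x - T (\<kappa> j) x) \<le> (1 / 2) ^ j + D j x" for j
      proof -
        define a where "a = cmod (T (\<kappa> (Suc j)) x - T (\<kappa> j) x)"
        have "sqrt ((1 / 2) ^ j) * sqrt (2 ^ j) = 1"
          by (simp flip: real_sqrt_mult power_mult_distrib)
        then have "2 * a = 2 * sqrt ((1 / 2) ^ j) * (sqrt (2 ^ j) * a)"
          by (metis mult.assoc mult.right_neutral)
        also have "\<dots> \<le> (sqrt ((1 / 2) ^ j))\<^sup>2 + (sqrt (2 ^ j) * a)\<^sup>2"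
          by (rule sum_squares_bound)
        also have "\<dots> = (1 / 2) ^ j + 2 ^ j * a\<^sup>2"
          by (simp add: power_mult_distrib)
        finally have "2 * a \<le> (1 / 2) ^ j + 2 ^ j * a\<^sup>2" .
        moreover have "0 \<le> a" "(0::real) \<le> (1 / 2) ^ j" "0 \<le> 2 ^ j * a\<^sup>2"
          by (auto simp: a_def)
        ultimately show ?thesis
          unfolding D_def a_def[symmetric] by linarith
      qed
      have "summable (\<lambda>j. T (\<kappa> (Suc j)) x - T (\<kappa> j) x)"
        using le by (intro summable_comparison_test'[OF sum, of 0])
      then have "convergent (\<lambda>j. T (\<kappa> j) x - T (\<kappa> 0) x)"
        by (simp add: summable_iff_convergent sum_lessThan_telescope[of "\<lambda>j. T (\<kappa> j) x"])
      from convergent_add[OF this convergent_const[of "T (\<kappa> 0) x"]]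
      have "convergent (\<lambda>j. T (\<kappa> j) x)"
        by simp
      then show "(\<lambda>j. T (\<kappa> j) x) \<longlonglongrightarrow> f x"
        unfolding f_def by (simp add: convergent_LIMSEQ_iff)
    qed
  qed

  have fatou: "(\<integral>\<^sup>+x. ennreal ((cmod (T K x - f x))\<^sup>2) \<partial>torus) \<le> ennreal (2 * pi * (S - s K))" for K
  proof -
    have "(\<integral>\<^sup>+x. ennreal ((cmod (T K x - f x))\<^sup>2) \<partial>torus) =
        (\<integral>\<^sup>+x. liminf (\<lambda>j. ennreal ((cmod (T K x - T (\<kappa> j) x))\<^sup>2)) \<partial>torus)"
    proof (rule nn_integral_cong_AE)
      show "AE x in torus. ennreal ((cmod (T K x - f x))\<^sup>2) = liminf (\<lambda>j. ennreal ((cmod (T K x - T (\<kappa> j) x))\<^sup>2))"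
        using conv
      proof eventually_elim
        fix x assume "(\<lambda>j. T (\<kappa> j) x) \<longlonglongrightarrow> f x"
        then have "(\<lambda>j. ennreal ((cmod (T K x - T (\<kappa> j) x))\<^sup>2)) \<longlonglongrightarrow> ennreal ((cmod (T K x - f x))\<^sup>2)"
          by (intro tendsto_ennrealI tendsto_intros)
        then show "ennreal ((cmod (T K x - f x))\<^sup>2) = liminf (\<lambda>j. ennreal ((cmod (T K x - T (\<kappa> j) x))\<^sup>2))"
          using lim_imp_Liminf[OF trivial_limit_sequentially] by metis
      qed
    qed
    also have "\<dots> \<le> liminf (\<lambda>j. \<integral>\<^sup>+x. ennreal ((cmod (T K x - T (\<kappa> j) x))\<^sup>2) \<partial>torus)"
      by (rule nn_integral_liminf) measurable
    also have "\<dots> = liminf (\<lambda>j. ennreal (2 * pi * \<bar>s K - s (\<kappa> j)\<bar>))"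
      by (simp add: nn_integral_torus_dist[OF T_L2 T_L2] T_dist)
    also have "\<dots> = ennreal (2 * pi * \<bar>s K - S\<bar>)"
    proof (intro lim_imp_Liminf trivial_limit_sequentially tendsto_ennrealI tendsto_intros)
      show "(\<lambda>j. s (\<kappa> j)) \<longlonglongrightarrow> S"
      proof (rule tendsto_sandwich[of "\<lambda>j. S - (1 / 4) ^ j" _ _ "\<lambda>_. S"])
        have "(\<lambda>j. S - (1 / 4) ^ j) \<longlonglongrightarrow> S - 0"
          by (intro tendsto_intros LIMSEQ_realpow_zero) auto
        then show "(\<lambda>j. S - (1 / 4) ^ j) \<longlonglongrightarrow> S"
          by simp
        show "eventually (\<lambda>j. S - (1 / 4) ^ j \<le> s (\<kappa> j)) sequentially"
          using \<kappa> by (intro always_eventually allI) (simp add: less_imp_le algebra_simps)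
      qed (use S(2) in auto)
    qed
    also have "\<bar>s K - S\<bar> = S - s K"
      using S(2)[of K] by simp
    finally show ?thesis .
  qed

  have int: "integrable torus (\<lambda>x. (cmod (T K x - f x))\<^sup>2)" for K
    using fatou[of K] by (intro integrableI_bounded) (auto intro: le_less_trans)
  have dist: "torus_dist (T K) f \<le> sqrt (2 * pi * (S - s K))" for K
    using fatou[of K] S(2)[of K] by (simp add: torus_dist_def nn_integral_eq_integral[OF int] ennreal_le_iff)
  have "f \<in> torus_L2"
    unfolding torus_L2_iff
  proof (intro conjI allI)
    show "f (x + 2 * pi) = f x" for x
      by (simp add: f_def T_def trig_periodic)
    have "integrable torus (\<lambda>x. (cmod (T 0 x + - (T 0 x - f x)))\<^sup>2)"
    proof (rule integrable_torus_norm_add_square)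
      show "integrable torus (\<lambda>x. (cmod (- (T 0 x - f x)))\<^sup>2)"
        using int[of 0] by (simp only: norm_minus_cancel)
      show "integrable torus (\<lambda>x. (cmod (T 0 x))\<^sup>2)"
        using T_L2[of 0] by (simp add: torus_L2_iff)
    qed measurable
    then show "integrable torus (\<lambda>x. (cmod (f x))\<^sup>2)"
      by simp
  qed simp
  moreover have "(\<lambda>K. torus_dist (T K) f) \<longlonglongrightarrow> 0"
  proof (rule tendsto_sandwich[of "\<lambda>_. 0" _ _ "\<lambda>K. sqrt (2 * pi * (S - s K))"])
    have "(\<lambda>K. sqrt (2 * pi * (S - s K))) \<longlonglongrightarrow> sqrt (2 * pi * (S - S))"
      by (intro tendsto_intros S)
    then show "(\<lambda>K. sqrt (2 * pi * (S - s K))) \<longlonglongrightarrow> 0"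
      by simp
  qed (use dist in auto)
  ultimately show ?thesis
    unfolding T_def by blast
qed

text \<open>Converse of \<open>riesz_fischer\<close>: partial sums at bounded distance from
  \<open>f\<close> are at bounded distance from the zero polynomial \<open>trig {} c\<close>, and
  Parseval applies. A natural number as bound keeps the quantifier countable.\<close>

lemma fourier_sum_bounded:
  assumes f: "f \<in> torus_L2" and lim: "(\<lambda>K. torus_dist (trig {- int K..int K} c) f) \<longlonglongrightarrow> 0"
  shows "\<exists>B::nat. \<forall>K. (\<Sum>n\<in>{- int K..int K}. (cmod (c n))\<^sup>2) \<le> B"
proof -
  obtain b where b: "\<And>K. torus_dist (trig {- int K..int K} c) f \<le> b"
    using convergent_imp_Bseq[OF convergentI[OF lim]] by (auto simp: Bseq_def)
  define d where "d = b + torus_dist f (trig {} c)"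
  obtain B :: nat where B: "d\<^sup>2 \<le> real B"
    using real_arch_simple by blast
  have "(\<Sum>n\<in>{- int K..int K}. (cmod (c n))\<^sup>2) \<le> B" for K
  proof -
    let ?s = "\<Sum>n\<in>{- int K..int K}. (cmod (c n))\<^sup>2"
    have "sqrt (2 * pi * ?s) = torus_dist (trig {- int K..int K} c) (trig {} c)"
      by (simp add: torus_dist_def parseval_trig trig_def[of "{}"])
    also have "\<dots> \<le> d"
      unfolding d_def using b[of K] torus_dist_triangle[OF trig_L2 f trig_L2, of "{- int K..int K}" c "{}" c]
      by linarith
    finally have "2 * pi * ?s \<le> d\<^sup>2"
      by (simp add: sqrt_le_D)
    moreover have "?s \<le> 2 * pi * ?s"
      using pi_gt3 by (intro mult_le_cancel_right1[THEN iffD2]) (auto simp: sum_nonneg not_less)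
    ultimately show ?thesis
      using B by linarith
  qed
  then show ?thesis
    by blast
qed

section \<open>The law of the random Fourier series\<close>

definition gaussian_coeff :: "real \<Rightarrow> (int \<Rightarrow> 'a \<Rightarrow> complex) \<Rightarrow> 'a \<Rightarrow> int \<Rightarrow> complex" where
  "gaussian_coeff \<alpha> g \<omega> n = 1 / of_real (sqrt (1 + \<bar>real_of_int n\<bar> powr (2 * \<alpha>))) * g n \<omega>"

lemma random_fourier_partial_sum_eq:
  "random_fourier_partial_sum \<alpha> g K \<omega> = trig {- int K..int K} (gaussian_coeff \<alpha> g \<omega>)"
  by (simp add: random_fourier_partial_sum_def trig_def gaussian_coeff_def fun_eq_iff)

lemma is_random_fourier_sum_eq:
  "is_random_fourier_sum \<alpha> g \<omega> f \<longleftrightarrow> f \<in> torus_L2 \<and>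
     (\<lambda>K. torus_dist (trig {- int K..int K} (gaussian_coeff \<alpha> g \<omega>)) f) \<longlonglongrightarrow> 0"
  by (simp add: is_random_fourier_sum_def torus_Lp_norm_2_diff random_fourier_partial_sum_eq)

text \<open>Quantification over all functions is traded for a countable condition on the
  coefficients, which makes the set of convergence measurable.\<close>

lemma ex_is_random_fourier_sum_iff:
  "(\<exists>f. is_random_fourier_sum \<alpha> g \<omega> f) \<longleftrightarrow>
     (\<exists>B::nat. \<forall>K. (\<Sum>n\<in>{- int K..int K}. (cmod (gaussian_coeff \<alpha> g \<omega> n))\<^sup>2) \<le> B)"
proof
  assume "\<exists>f. is_random_fourier_sum \<alpha> g \<omega> f"
  then show "\<exists>B::nat. \<forall>K. (\<Sum>n\<in>{- int K..int K}. (cmod (gaussian_coeff \<alpha> g \<omega> n))\<^sup>2) \<le> B"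
    using fourier_sum_bounded by (auto simp: is_random_fourier_sum_eq)
next
  assume "\<exists>B::nat. \<forall>K. (\<Sum>n\<in>{- int K..int K}. (cmod (gaussian_coeff \<alpha> g \<omega> n))\<^sup>2) \<le> B"
  then show "\<exists>f. is_random_fourier_sum \<alpha> g \<omega> f"
    using riesz_fischer[of "gaussian_coeff \<alpha> g \<omega>"] by (auto simp: is_random_fourier_sum_eq)
qed

lemma is_random_fourier_sum_series:
  "\<exists>f. is_random_fourier_sum \<alpha> g \<omega> f \<Longrightarrow> is_random_fourier_sum \<alpha> g \<omega> (random_fourier_series \<alpha> g \<omega>)"
  unfolding random_fourier_series_def by (simp add: someI_ex)

lemma zero_eq_trig: "(\<lambda>_. 0) = trig A (\<lambda>_. 0)"
  by (simp add: trig_def fun_eq_iff)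

lemma random_fourier_series_L2: "random_fourier_series \<alpha> g \<omega> \<in> torus_L2"
proof (cases "\<exists>f. is_random_fourier_sum \<alpha> g \<omega> f")
  case True
  then show ?thesis
    using is_random_fourier_sum_series[OF True] by (simp add: is_random_fourier_sum_eq)
next
  case False
  then show ?thesis
    using trig_L2[of "{}" "\<lambda>_. 0"] by (simp add: random_fourier_series_def flip: zero_eq_trig)
qed

text \<open>The choice made by \<open>SOME\<close> is harmless: any sum is a limit of the measurable
  partial sums in the seminorm, and this is all that \<open>measurable_torus_L2_borel_limit\<close>
  asks for.\<close>

lemma measurable_random_fourier_series:
  assumes [measurable]: "\<And>n. g n \<in> borel_measurable M"
  shows "random_fourier_series \<alpha> g \<in> measurable M torus_L2_borel"
proof (rule measurable_torus_L2_borel_limit)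
  \<comment> \<open>Cutting the coefficients to 0 where the series diverges makes the partial sums
    converge everywhere, there to the default value \<open>\<lambda>_. 0\<close>.\<close>
  define c where "c \<omega> n = (if \<exists>f. is_random_fourier_sum \<alpha> g \<omega> f then gaussian_coeff \<alpha> g \<omega> n else 0)" for \<omega> n
  have [measurable]: "(\<lambda>\<omega>. gaussian_coeff \<alpha> g \<omega> n) \<in> borel_measurable M" for n
    unfolding gaussian_coeff_def by measurable
  have [measurable]: "(\<lambda>\<omega>. c \<omega> n) \<in> borel_measurable M" for n
    unfolding c_def ex_is_random_fourier_sum_iff by measurable
  show "(\<lambda>\<omega>. trig {- int K..int K} (c \<omega>)) \<in> measurable M torus_L2_borel" for K
    by (rule measurable_trig_torus_L2_borel) auto
  show "(\<lambda>K. torus_dist (trig {- int K..int K} (c \<omega>)) (random_fourier_series \<alpha> g \<omega>)) \<longlonglongrightarrow> 0" for \<omega>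
  proof (cases "\<exists>f. is_random_fourier_sum \<alpha> g \<omega> f")
    case True
    then have "c \<omega> = gaussian_coeff \<alpha> g \<omega>"
      by (simp add: c_def fun_eq_iff)
    with is_random_fourier_sum_series[OF True] show ?thesis
      by (simp add: is_random_fourier_sum_eq)
  next
    case False
    then have "c \<omega> = (\<lambda>_. 0)" "random_fourier_series \<alpha> g \<omega> = (\<lambda>_. 0)"
      by (auto simp: c_def random_fourier_series_def fun_eq_iff)
    then show ?thesis
      by (simp flip: zero_eq_trig)
  qed
qed (rule random_fourier_series_L2)

text \<open>All partial sums of order at least \<open>|n|\<close> have the same \<open>n\<close>-th
  coefficient, and the coefficient is continuous in the seminorm, so every representative of the
  limit inherits it.\<close>

lemma torus_fourier_coeff_random_fourier_series:
  assumes "\<exists>f. is_random_fourier_sum \<alpha> g \<omega> f"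
  shows "torus_fourier_coeff (random_fourier_series \<alpha> g \<omega>) n = gaussian_coeff \<alpha> g \<omega> n"
proof -
  let ?f = "random_fourier_series \<alpha> g \<omega>" and ?c = "gaussian_coeff \<alpha> g \<omega>"
  have lim: "(\<lambda>K. torus_dist (trig {- int K..int K} ?c) ?f) \<longlonglongrightarrow> 0"
    using is_random_fourier_sum_series[OF assms] by (simp add: is_random_fourier_sum_eq)
  have "cmod (?c n - torus_fourier_coeff ?f n) \<le> torus_dist (trig {- int K..int K} ?c) ?f" if "nat \<bar>n\<bar> \<le> K" for K
  proof -
    have "n \<in> {- int K..int K}"
      using that by auto
    then show ?thesis
      using torus_fourier_coeff_dist[OF trig_L2[of "{- int K..int K}" ?c] random_fourier_series_L2[of \<alpha> g \<omega>], of n]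
      by (simp add: torus_fourier_coeff_trig)
  qed
  then have "cmod (?c n - torus_fourier_coeff ?f n) \<le> 0"
    by (intro tendsto_lowerbound[OF lim]) (auto simp: eventually_sequentially)
  then show ?thesis
    by simp
qed

text \<open>
  Where the series diverges the weight is at most \<open>1\<close>, so almost sure convergence is irrelevant here.
\<close>

lemma truncated_weight_random_fourier_series_le:
  assumes "0 < R"
  shows "truncated_weight R lam N (random_fourier_series \<alpha> g \<omega>) \<le>
    1 + indicator {\<omega>. 2 * pi * (\<Sum>n\<in>{- int N..int N}. (cmod (gaussian_coeff \<alpha> g \<omega> n))\<^sup>2) \<le> R\<^sup>2} \<omega> *
      exp (max 0 lam * (LINT x|torus. cmod (trig {- int N..int N} (gaussian_coeff \<alpha> g \<omega>) x) ^ 4))"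
proof (cases "\<exists>f. is_random_fourier_sum \<alpha> g \<omega> f")
  case True
  let ?c = "gaussian_coeff \<alpha> g \<omega>"
  let ?I = "LINT x|torus. cmod (trig {- int N..int N} ?c x) ^ 4"
  have "torus_fourier_coeff (random_fourier_series \<alpha> g \<omega>) = ?c"
    using torus_fourier_coeff_random_fourier_series[OF True] by auto
  then have w: "truncated_weight R lam N (random_fourier_series \<alpha> g \<omega>) =
      (if sqrt (2 * pi * (\<Sum>n\<in>{- int N..int N}. (cmod (?c n))\<^sup>2)) \<le> R then exp (lam * ?I) else 0)"
    by (simp add: truncated_weight_def fourier_proj_eq_trig torus_Lp_norm_4_power torus_Lp_norm_2
        parseval_trig indicator_def)
  have "0 \<le> ?I"
    by (intro integral_nonneg_AE) auto
  \<comment> \<open>Enlarging \<open>lam\<close> to \<open>max 0 lam\<close> provides the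
    nonnegative constant that \<open>truncated_expectation_bound\<close> requires.\<close>
  then have "exp (lam * ?I) \<le> exp (max 0 lam * ?I)"
    by (simp add: mult_right_mono)
  then show ?thesis
    unfolding w using sqrt_le_D by (auto simp: indicator_def intro: add_increasing)
next
  case False
  then have "torus_fourier_coeff (random_fourier_series \<alpha> g \<omega>) = (\<lambda>_. 0)"
    by (simp add: random_fourier_series_def torus_fourier_coeff_eq fun_eq_iff)
  then have "truncated_weight R lam N (random_fourier_series \<alpha> g \<omega>) \<le> 1"
    by (simp add: truncated_weight_def fourier_proj_eq_trig torus_Lp_norm_4_power indicator_def
        flip: zero_eq_trig)
  then show ?thesis
    by (rule add_increasing2[rotated]) simp
qed

theorem proposition5p8:
  fixes M :: "'a measure" and g :: "int \<Rightarrow> 'a \<Rightarrow> complex" and \<alpha> R lam :: real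
  assumes "prob_space M"
    and "iid_std_complex_gaussian M g"
    and "\<alpha> > 3 / 4"
    and "R > 0"
  shows "\<exists>C::real. \<forall>N::nat.
    integrable (gaussian_law M g \<alpha>) (truncated_weight R lam N) \<and>
    (LINT v|gaussian_law M g \<alpha>. truncated_weight R lam N v) \<le> C"
proof -
  interpret prob_space M by fact
  note [measurable] = iid_std_complex_gaussian_measurable[OF assms(2)]
  have X: "random_fourier_series \<alpha> g \<in> measurable M torus_L2_borel"
    by (rule measurable_random_fourier_series) simp
  note [measurable] = measurable_truncated_weight
  have norm_weight: "(cmod (1 / of_real (sqrt (1 + \<bar>real_of_int n\<bar> powr (2 * \<alpha>)))))\<^sup>2 =
      1 / (1 + \<bar>real_of_int n\<bar> powr (2 * \<alpha>))" for n
    by (simp add: norm_divide power_divide)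
  define b where "b N \<omega> = (indicator {\<omega>. 2 * pi * (\<Sum>n\<in>{- int N..int N}. (cmod (gaussian_coeff \<alpha> g \<omega> n))\<^sup>2) \<le> R\<^sup>2} \<omega> *
      exp (max 0 lam * (LINT x|torus. cmod (trig {- int N..int N} (gaussian_coeff \<alpha> g \<omega>) x) ^ 4)) :: real)" for N \<omega>
  have "ennreal (b N \<omega>) =
      indicator {\<omega>. 2 * pi * (\<Sum>n\<in>{- int N..int N}. (cmod (gaussian_coeff \<alpha> g \<omega> n))\<^sup>2) \<le> R\<^sup>2} \<omega> *
      ennreal (exp (max 0 lam * (LINT x|torus. cmod (trig {- int N..int N} (gaussian_coeff \<alpha> g \<omega>) x) ^ 4)))" for N \<omega>
    by (simp add: b_def indicator_def)
  moreover have "gaussian_coeff \<alpha> g \<omega> =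
      (\<lambda>n. 1 / of_real (sqrt (1 + \<bar>real_of_int n\<bar> powr (2 * \<alpha>))) * g n \<omega>)" for \<omega>
    by (simp add: gaussian_coeff_def fun_eq_iff)
  ultimately obtain B where B: "0 \<le> B" "\<And>N. (\<integral>\<^sup>+\<omega>. ennreal (b N \<omega>) \<partial>M) \<le> ennreal B"
    using truncated_expectation_bound[OF assms(2,3), of "R\<^sup>2" "max 0 lam", OF _ _ norm_weight]
    by (simp only: zero_le_power2 max.cobounded1) blast
  have [measurable]: "(\<lambda>\<omega>. gaussian_coeff \<alpha> g \<omega> n) \<in> borel_measurable M" for n
    unfolding gaussian_coeff_def by measurable
  have [measurable]: "b N \<in> borel_measurable M" for N
    unfolding b_def[abs_def] indicator_def mem_Collect_eq by measurable
  have weight_nonneg: "0 \<le> truncated_weight R lam N v" for N v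
    by (simp add: truncated_weight_def)
  have bound: "(\<integral>\<^sup>+\<omega>. ennreal (truncated_weight R lam N (random_fourier_series \<alpha> g \<omega>)) \<partial>M) \<le> ennreal (1 + B)" for N
  proof -
    have "(\<integral>\<^sup>+\<omega>. ennreal (truncated_weight R lam N (random_fourier_series \<alpha> g \<omega>)) \<partial>M) \<le>
        (\<integral>\<^sup>+\<omega>. 1 + ennreal (b N \<omega>) \<partial>M)"
      using truncated_weight_random_fourier_series_le[OF assms(4)]
      by (intro nn_integral_mono) (auto simp: b_def ennreal_leI simp flip: ennreal_1 ennreal_plus)
    also have "\<dots> = 1 + (\<integral>\<^sup>+\<omega>. ennreal (b N \<omega>) \<partial>M)"
      by (simp add: nn_integral_add emeasure_space_1)
    also have "\<dots> \<le> 1 + ennreal B"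
      by (intro add_left_mono B)
    finally show ?thesis
      using B(1) by simp
  qed
  \<comment> \<open>Integrability carries content of its own: the integral of a non-integrable
    function is 0 by convention, so the bound alone could hold vacuously.\<close>
  have int: "integrable M (\<lambda>\<omega>. truncated_weight R lam N (random_fourier_series \<alpha> g \<omega>))" for N
  proof (rule integrableI_nonneg)
    show "(\<lambda>\<omega>. truncated_weight R lam N (random_fourier_series \<alpha> g \<omega>)) \<in> borel_measurable M"
      using X by measurable
    show "(\<integral>\<^sup>+\<omega>. ennreal (truncated_weight R lam N (random_fourier_series \<alpha> g \<omega>)) \<partial>M) < \<infinity>"
      using bound[of N] by (auto intro: le_less_trans)
  qed (simp add: weight_nonneg)
  have "integrable (gaussian_law M g \<alpha>) (truncated_weight R lam N)" for N
    unfolding gaussian_law_def using int by (subst integrable_distr_eq[OF X]) auto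
  moreover have "(LINT v|gaussian_law M g \<alpha>. truncated_weight R lam N v) \<le> 1 + B" for N
  proof -
    have "(LINT v|gaussian_law M g \<alpha>. truncated_weight R lam N v) =
        (LINT \<omega>|M. truncated_weight R lam N (random_fourier_series \<alpha> g \<omega>))"
      unfolding gaussian_law_def by (rule integral_distr[OF X]) simp
    moreover have "ennreal (LINT \<omega>|M. truncated_weight R lam N (random_fourier_series \<alpha> g \<omega>)) \<le> ennreal (1 + B)"
      using bound[of N] by (subst nn_integral_eq_integral[symmetric]) (auto simp: int weight_nonneg)
    ultimately show ?thesis
      using B(1) by (simp add: ennreal_le_iff del: ennreal_plus)
  qed
  ultimately show ?thesis
    by blast
qed

end
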